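(* Let $M$ be a $d$-dimensional smooth manifold, $T, m\in\mathbb{N}$, and consider the optimal control problem $$\text{(P)}\quad \min_{(u_t)_{t=0}^{T-1}}\ \sum_{t=0}^{T-1} c_t(x_t,u_t)+c_T(x_T)\quad\text{subject to}\quad \begin{cases} x_{t+1}=f_t(x_t,u_t), & t=0,\dots,T-1,\\ x_0=\bar x,\\ g_t(x_t)\le 0, & t=1,\dots,T,\\ u_t\in U_t, & t=0,\dots,T-1,\\ \sum_{t=0}^{T-1}F_t u_t=0,\end{cases}$$ with the data described in the context: $\bar x\in M$; $f_t:M\times\mathbb{R}^m\to M$, $c_t:M\times\mathbb{R}^m\to\mathbb{R}$ ($t=0,\dots,T-1$), $c_T:M\to\mathbb{R}$ and $g_t:M\to\mathbb{R}^{n_t}$ ($t=1,\dots,T$) continuously differentiable; $U_t\subset\mathbb{R}^m$ non-empty and otherwise arbitrary; and $F_t\in\mathbb{R}^{\ell\times m}$ matrices encoding the frequency constraints. Let $\bigl((x_t^* )_{t=0}^{T},(u_t^* )_{t=0}^{T-1}\bigr)$ be an optimal state-action trajectory for (P), and for each $t=0,\dots,T-1$ let $q_t(u_t^* )\subset\mathbb{R}^m$ be a local tent of $U_t$ at $u_t^*$. Then there exist - a sequence $(\eta^{f}_t)_{t=1}^{T}$ with $\eta^{f}_t\in T^*_{x_t^*}M$ for each $t$, - a sequence $(\eta^{x}_t)_{t=1}^{T}$ with $\eta^{x}_t\in(\mathbb{R}^{n_t})^*$ for each $t$, and - a pair $(\eta^{c},\eta^{u})\in\mathbb{R}\times(\mathbb{R}^\ell)^*$,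 satisfying the following conditions: (i) (non-negativity) $\eta^{c}\ge 0$ and $\eta^{x}_t\ge 0$ (componentwise) for $t=1,\dots,T$; (ii) (non-triviality) the sequence $(\eta^{x}_t)_{t=1}^T$ and the pair $(\eta^{c},\eta^{u})$ do not simultaneously vanish; (iii) (state and adjoint dynamics) $x^*_{t+1}=f_t(x_t^*,u_t^* )$ for $t=0,\dots,T-1$, and $$\eta^{f}_t=T^*_xf_t(x_t^*,u_t^* )\,\eta^{f}_{t+1}-\eta^{c}\,d_xc_t(x_t^*,u_t^* )-T^*g_t(x_t^* )\,\eta^{x}_t\qquad\text{for } t=1,\dots,T-1;$$ (iv) (transversality) $\eta^{f}_T=-\eta^{c}\,dc_T(x_T^* )-T^*g_T(x_T^* )\,\eta^{x}_T$; (v) (Hamiltonian maximization, pointwise in time) for each $t=0,\dots,T-1$, $$\Bigl\langle T^*_uf_t(x_t^*,u_t^* )\,\eta^{f}_{t+1}-\eta^{c}\,d_uc_t(x_t^*,u_t^* )+F_t^{\top}\eta^{u},\ \tilde u_t\Bigr\rangle\le 0\quad\text{whenever } u_t^*+\tilde u_t\in q_t(u_t^* );$$ (vi) (complementary slackness) $(\eta^{x}_t)^j\,g_t^j(x_t^* )=0$ for all $j\in\{1,\dots,n_t\}$ and $t=1,\dots,T$.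
   Context: **Data.** Inequalities between vectors are componentwise; $v^j$ is the $j$-th component of $v$; $n_t,\ell\in\mathbb{N}$. The spaces $(\mathbb{R}^k)^*$ and cotangent spaces of $\mathbb{R}^k$ are identified with $\mathbb{R}^k$ via the standard inner product $\langle\cdot,\cdot\rangle$. **Frequency constraints.** For $k=1,\dots,m$, let $\hat u^{(k)}_\xi=\sum_{t=0}^{T-1}u_t^{(k)}e^{-\mathrm{i}2\pi\xi t/T}$, $\xi=0,\dots,T-1$, be the discrete Fourier transform of the $k$-th component $(u_t^{(k)})_{t=0}^{T-1}$ of the control sequence. Given sets $W^{(k)}\subset\{1,\dots,T\}$, the frequency constraint requires, for each $k$, that the support of $\hat u^{(k)}\in\mathbb{C}^T$ (the set of $i\in\{1,\dots,T\}$ such that the $i$-th entry of the vector is non-zero) be contained in $W^{(k)}$. The matrices $F_t\in\mathbb{R}^{\ell\times m}$, $t=0,\dots,T-1$, depend on the sets $W^{(k)}$ and are such that this constraint is equivalent to $\sum_{t=0}^{T-1}F_tu_t=0$. **Optimal trajectory.** $\bigl((x_t^* )_{t=0}^{T},(u_t^* )_{t=0}^{T-1}\bigr)$ is an optimal state-action trajectory if it satisfies all the constraints of (P) and attains the minimum of the cost among all pairs satisfying the constraints. **Cotangent lifts.** For a differentiable map $f:M_1\to M_2$ between manifolds, $Tf(x_0):T_{x_0}M_1\to T_{f(x_0)}M_2$ is its tangent map at $x_0$ and $T^*f(x_0):T^*_{f(x_0)}M_2\to T^*_{x_0}M_1$ is the dual linear map (cotangent lift). For real-valued $f$, $df$ is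 its differential. $T^*_xf_t(x_0,u_0)$ is the cotangent lift at $x_0$ of $f_t(\cdot,u_0):M\to M$; $T^*_uf_t(x_0,u_0)$ is the cotangent lift at $u_0$ of $f_t(x_0,\cdot):\mathbb{R}^m\to M$; $d_xc_t(x_0,u_0)$ and $d_uc_t(x_0,u_0)$ are the differentials of $c_t(\cdot,u_0)$ at $x_0$ and of $c_t(x_0,\cdot)$ at $u_0$. **Tents.** A cone with vertex $z_0$ is a set of the form $z_0+K$ with $K\neq\emptyset$ and $\alpha y\in K$ for all $y\in K$, $\alpha\ge0$. Let $\Omega\subset\mathbb{R}^\nu$ and $z_0\in\Omega$. A convex cone $Q\subset\mathbb{R}^\nu$ with vertex $z_0$ is a *tent* of $\Omega$ at $z_0$ if there is a smooth map $\varphi$ defined in a neighbourhood of $z_0$ (with values in $\mathbb{R}^\nu$) such that $\varphi(z)=z+o(z-z_0)$, and there exists $\epsilon>0$ such that $\varphi(z)\in\Omega$ for all $z\in Q$ with $|z-z_0|<\epsilon$. A convex cone $K\subset\mathbb{R}^\nu$ with vertex $z_0$ is a *local tent* of $\Omega$ at $z_0$ if for every $z$ in the relative interior of $K$ there is a convex cone $Q\subset K$ with vertex $z_0$ such that $Q$ is a tent of $\Omega$ at $z_0$, $z$ lies in the relative interior of $Q$, and $\operatorname{aff}Q=\operatorname{aff}K$, where $\operatorname{aff}$ denotes affine hull and relative interior is interior relative to the affine hull. *)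

theory Defs
  imports "HOL-Analysis.Analysis" "HOL-Library.Landau_Symbols"
begin

section \<open>Maps of class \<open>C\<^sup>k\<close> on open subsets of Euclidean spaces\<close>

text \<open>Only meant for open \<open>S\<close>. In finite dimension, continuity of the derivative in the operator norm
  amounts to continuity of all directional derivatives.\<close>

fun Ck_on :: "nat \<Rightarrow> 'e::euclidean_space set \<Rightarrow> ('e \<Rightarrow> 'b::euclidean_space) \<Rightarrow> bool" where
  "Ck_on 0 S f \<longleftrightarrow> continuous_on S f"
| "Ck_on (Suc k) S f \<longleftrightarrow>
     f differentiable_on S \<and> (\<forall>v. Ck_on k S (\<lambda>x. frechet_derivative f (at x) v))"

definition smooth_on :: "'e::euclidean_space set \<Rightarrow> ('e \<Rightarrow> 'b::euclidean_space) \<Rightarrow> bool" where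
  "smooth_on S f \<longleftrightarrow> (\<forall>k. Ck_on k S f)"


section \<open>Smooth manifolds\<close>

text \<open>A chart is a pair of its domain and its coordinate map; the values of the coordinate map outside
  the domain are irrelevant. A manifold is a topological space with a (not necessarily maximal) smooth
  atlas; its dimension is \<open>DIM('e)\<close>.\<close>

type_synonym ('a, 'e) chart = "'a set \<times> ('a \<Rightarrow> 'e)"

definition is_chart :: "'a topology \<Rightarrow> ('a, 'e::euclidean_space) chart \<Rightarrow> bool" where
  "is_chart M c \<longleftrightarrow> openin M (fst c) \<and> open (snd c ` fst c) \<and>
     homeomorphic_map (subtopology M (fst c)) (top_of_set (snd c ` fst c)) (snd c)"

definition charts_at :: "('a, 'e) chart set \<Rightarrow> 'a \<Rightarrow> ('a, 'e) chart set" where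
  "charts_at A x = {c \<in> A. x \<in> fst c}"

definition local_rep ::
  "('a \<Rightarrow> 'b) \<Rightarrow> ('a, 'e) chart \<Rightarrow> ('b, 'h) chart \<Rightarrow> 'e \<Rightarrow> 'h" where
  "local_rep f c c' = snd c' \<circ> f \<circ> inv_into (fst c) (snd c)"

definition smooth_manifold :: "'a topology \<Rightarrow> ('a, 'e::euclidean_space) chart set \<Rightarrow> bool" where
  "smooth_manifold M A \<longleftrightarrow>
     Hausdorff_space M \<and> second_countable M \<and>
     (\<forall>c\<in>A. is_chart M c) \<and> (\<Union>c\<in>A. fst c) = topspace M \<and>
     (\<forall>c\<in>A. \<forall>c'\<in>A. smooth_on (snd c ` (fst c \<inter> fst c')) (local_rep id c c'))"

definition C1_map ::
  "'a topology \<Rightarrow> ('a, 'e::euclidean_space) chart set \<Rightarrow>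
   'b topology \<Rightarrow> ('b, 'h::euclidean_space) chart set \<Rightarrow> ('a \<Rightarrow> 'b) \<Rightarrow> bool" where
  "C1_map M A N B f \<longleftrightarrow> continuous_map M N f \<and>
     (\<forall>c\<in>A. \<forall>c'\<in>B. Ck_on 1 (snd c ` {x \<in> fst c. f x \<in> fst c'}) (local_rep f c c'))"

definition euc_atlas :: "('e::euclidean_space, 'e) chart set" where
  "euc_atlas = {(UNIV, id)}"

definition prod_atlas ::
  "('a, 'e::euclidean_space) chart set \<Rightarrow> ('b, 'h::euclidean_space) chart set \<Rightarrow>
   ('a \<times> 'b, 'e \<times> 'h) chart set" where
  "prod_atlas A B = {(fst c \<times> fst c', map_prod (snd c) (snd c')) | c c'. c \<in> A \<and> c' \<in> B}"


subsection \<open>Tangent and cotangent spaces\<close>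

text \<open>A tangent vector at \<open>x\<close> is the family of its coordinate vectors in all charts around \<open>x\<close>, related by
  the derivatives of the transition maps; it is \<open>0\<close> at charts that are not around \<open>x\<close>. Defining it by
  derivations of smooth functions would not allow push-forward along maps that are only \<open>C\<^sup>1\<close>.\<close>

type_synonym ('a, 'e) tangent = "('a, 'e) chart \<Rightarrow> 'e"

definition tangent_space ::
  "('a, 'e::euclidean_space) chart set \<Rightarrow> 'a \<Rightarrow> ('a, 'e) tangent set" where
  "tangent_space A x =
     {v. (\<forall>c\<in>charts_at A x. \<forall>c'\<in>charts_at A x.
            v c' = frechet_derivative (local_rep id c c') (at (snd c x)) (v c)) \<and>
         (\<forall>c. c \<notin> charts_at A x \<longrightarrow> v c = 0)}"

definition cotangent_space ::
  "('a, 'e::euclidean_space) chart set \<Rightarrow> 'a \<Rightarrow> (('a, 'e) tangent \<Rightarrow> real) set" where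
  "cotangent_space A x =
     {\<eta> \<in> extensional (tangent_space A x).
        \<forall>v\<in>tangent_space A x. \<forall>w\<in>tangent_space A x. \<forall>a b.
          \<eta> (\<lambda>c. a *\<^sub>R v c + b *\<^sub>R w c) = a * \<eta> v + b * \<eta> w}"

text \<open>By the chain rule, the result does not depend on the selected chart \<open>c\<close> around \<open>x\<close>.\<close>

definition tangent_map ::
  "('a, 'e::euclidean_space) chart set \<Rightarrow> ('b, 'h::euclidean_space) chart set \<Rightarrow>
   ('a \<Rightarrow> 'b) \<Rightarrow> 'a \<Rightarrow> ('a, 'e) tangent \<Rightarrow> ('b, 'h) tangent" where
  "tangent_map A B f x v =
     (let c = (SOME c. c \<in> charts_at A x)
      in (\<lambda>c'. if c' \<in> charts_at B (f x)
               then frechet_derivative (local_rep f c c') (at (snd c x)) (v c) else 0))"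

definition cotangent_lift ::
  "('a, 'e::euclidean_space) chart set \<Rightarrow> ('b, 'h::euclidean_space) chart set \<Rightarrow>
   ('a \<Rightarrow> 'b) \<Rightarrow> 'a \<Rightarrow> (('b, 'h) tangent \<Rightarrow> real) \<Rightarrow> ('a, 'e) tangent \<Rightarrow> real" where
  "cotangent_lift A B f x \<eta> = (\<lambda>v\<in>tangent_space A x. \<eta> (tangent_map A B f x v))"

text \<open>Evaluation at the chart \<open>(UNIV, id)\<close> identifies the tangent space of \<open>\<real>\<close> with \<open>\<real>\<close>.\<close>

definition differential ::
  "('a, 'e::euclidean_space) chart set \<Rightarrow> ('a \<Rightarrow> real) \<Rightarrow> 'a \<Rightarrow> ('a, 'e) tangent \<Rightarrow> real" where
  "differential A f x = (\<lambda>v\<in>tangent_space A x. tangent_map A euc_atlas f x v (UNIV, id))"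

text \<open>The identifications of a Euclidean space with its tangent spaces and, through the inner product,
  with its cotangent spaces: \<open>euc_vector \<eta> \<bullet> z = \<eta> (euc_tangent z)\<close> for every covector \<open>\<eta>\<close>.\<close>

definition euc_tangent :: "'e::euclidean_space \<Rightarrow> ('e, 'e) tangent" where
  "euc_tangent z = (\<lambda>c. if c \<in> euc_atlas then z else 0)"

definition euc_vector :: "(('e::euclidean_space, 'e) tangent \<Rightarrow> real) \<Rightarrow> 'e" where
  "euc_vector \<eta> = (\<Sum>b\<in>Basis. \<eta> (euc_tangent b) *\<^sub>R b)"


section \<open>\<open>\<real>\<^sup>n\<close> for varying \<open>n\<close>\<close>

text \<open>Since the number \<open>n\<^sub>t\<close> of state constraints depends on time, it cannot be a type index: vectors of
  \<open>\<real>\<^sup>n\<close> (and of its dual) are sequences whose components outside \<open>{1..n}\<close> vanish. The cotangent lift of a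
  map with values in \<open>\<real>\<^sup>n\<close>, given by its components, is
  \<open>\<eta> \<mapsto> \<eta> \<circ> Tg(x) = \<Sum>\<^sub>j \<eta>\<^sup>j dg\<^sup>j(x)\<close>.\<close>

definition nvec :: "nat \<Rightarrow> (nat \<Rightarrow> real) set" where
  "nvec n = {v. \<forall>j. j \<notin> {1..n} \<longrightarrow> v j = 0}"

definition cotangent_lift_nvec ::
  "('a, 'e::euclidean_space) chart set \<Rightarrow> nat \<Rightarrow> ('a \<Rightarrow> nat \<Rightarrow> real) \<Rightarrow> 'a \<Rightarrow> (nat \<Rightarrow> real) \<Rightarrow>
   ('a, 'e) tangent \<Rightarrow> real" where
  "cotangent_lift_nvec A n g x \<eta> =
     (\<lambda>v\<in>tangent_space A x. \<Sum>j=1..n. \<eta> j * differential A (\<lambda>y. g y j) x v)"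


section \<open>Tents\<close>

definition cone_with_vertex :: "'e::euclidean_space \<Rightarrow> 'e set \<Rightarrow> bool" where
  "cone_with_vertex z0 Q \<longleftrightarrow> (\<exists>K. K \<noteq> {} \<and> cone K \<and> Q = (\<lambda>y. z0 + y) ` K)"

text \<open>The filter \<open>nhds z0\<close> contains the point \<open>z0\<close> itself, so that \<open>\<phi> z0 = z0\<close> is part of the little-o
  condition.\<close>

definition tent :: "'e::euclidean_space set \<Rightarrow> 'e \<Rightarrow> 'e set \<Rightarrow> bool" where
  "tent \<Omega> z0 Q \<longleftrightarrow>
     z0 \<in> \<Omega> \<and> convex Q \<and> cone_with_vertex z0 Q \<and>
     (\<exists>\<phi> N. open N \<and> z0 \<in> N \<and> smooth_on N \<phi> \<and>
        (\<lambda>z. norm (\<phi> z - z)) \<in> o[nhds z0](\<lambda>z. norm (z - z0)) \<and>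
        (\<exists>\<epsilon>>0. \<forall>z\<in>Q. norm (z - z0) < \<epsilon> \<longrightarrow> z \<in> N \<and> \<phi> z \<in> \<Omega>))"

definition local_tent :: "'e::euclidean_space set \<Rightarrow> 'e \<Rightarrow> 'e set \<Rightarrow> bool" where
  "local_tent \<Omega> z0 K \<longleftrightarrow>
     z0 \<in> \<Omega> \<and> convex K \<and> cone_with_vertex z0 K \<and>
     (\<forall>z\<in>rel_interior K. \<exists>Q\<subseteq>K. tent \<Omega> z0 Q \<and> z \<in> rel_interior Q \<and>
        affine hull Q = affine hull K)"


section \<open>Frequency constraints\<close>

definition dft :: "nat \<Rightarrow> (nat \<Rightarrow> real) \<Rightarrow> nat \<Rightarrow> complex" where
  "dft T w \<xi> = (\<Sum>t<T. of_real (w t) * exp (- \<i> * 2 * of_real pi * of_nat \<xi> * of_nat t / of_nat T))"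

text \<open>The entries of the vector \<open>(dft T w 0, \<dots>, dft T w (T - 1))\<close> are numbered from \<open>1\<close>.\<close>

definition dft_support :: "nat \<Rightarrow> (nat \<Rightarrow> real) \<Rightarrow> nat set" where
  "dft_support T w = {i \<in> {1..T}. dft T w (i - 1) \<noteq> 0}"

text \<open>\<open>F t i\<close> is the \<open>i\<close>-th row, \<open>i \<in> {1..l}\<close>, of the \<open>l \<times> m\<close> matrix \<open>F\<^sub>t\<close>.\<close>

definition linear_constraint ::
  "nat \<Rightarrow> nat \<Rightarrow> (nat \<Rightarrow> nat \<Rightarrow> real^'m) \<Rightarrow> (nat \<Rightarrow> real^'m) \<Rightarrow> bool" where
  "linear_constraint T l F u \<longleftrightarrow> (\<forall>i\<in>{1..l}. (\<Sum>t<T. F t i \<bullet> u t) = 0)"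

definition encodes_frequency_constraint ::
  "nat \<Rightarrow> ('m \<Rightarrow> nat set) \<Rightarrow> nat \<Rightarrow> (nat \<Rightarrow> nat \<Rightarrow> real^'m) \<Rightarrow> bool" where
  "encodes_frequency_constraint T W l F \<longleftrightarrow>
     (\<forall>u. (\<forall>k. dft_support T (\<lambda>t. u t $ k) \<subseteq> W k) \<longleftrightarrow> linear_constraint T l F u)"


section \<open>The optimal control problem\<close>

definition admissible ::
  "'a topology \<Rightarrow> nat \<Rightarrow> 'a \<Rightarrow> (nat \<Rightarrow> 'a \<times> (real^'m) \<Rightarrow> 'a) \<Rightarrow>
   (nat \<Rightarrow> nat) \<Rightarrow> (nat \<Rightarrow> 'a \<Rightarrow> nat \<Rightarrow> real) \<Rightarrow> (nat \<Rightarrow> (real^'m) set) \<Rightarrow>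
   nat \<Rightarrow> (nat \<Rightarrow> nat \<Rightarrow> real^'m) \<Rightarrow> (nat \<Rightarrow> 'a) \<Rightarrow> (nat \<Rightarrow> real^'m) \<Rightarrow> bool" where
  "admissible M T xbar f n g U l F x u \<longleftrightarrow>
     (\<forall>t\<le>T. x t \<in> topspace M) \<and>
     (\<forall>t<T. x (Suc t) = f t (x t, u t)) \<and> x 0 = xbar \<and>
     (\<forall>t\<in>{1..T}. \<forall>j\<in>{1..n t}. g t (x t) j \<le> 0) \<and>
     (\<forall>t<T. u t \<in> U t) \<and>
     linear_constraint T l F u"

definition total_cost ::
  "nat \<Rightarrow> (nat \<Rightarrow> 'a \<times> (real^'m) \<Rightarrow> real) \<Rightarrow> ('a \<Rightarrow> real) \<Rightarrow>
   (nat \<Rightarrow> 'a) \<Rightarrow> (nat \<Rightarrow> real^'m) \<Rightarrow> real" where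
  "total_cost T c cT x u = (\<Sum>t<T. c t (x t, u t)) + cT (x T)"

definition optimal ::
  "'a topology \<Rightarrow> nat \<Rightarrow> 'a \<Rightarrow> (nat \<Rightarrow> 'a \<times> (real^'m) \<Rightarrow> 'a) \<Rightarrow>
   (nat \<Rightarrow> 'a \<times> (real^'m) \<Rightarrow> real) \<Rightarrow> ('a \<Rightarrow> real) \<Rightarrow>
   (nat \<Rightarrow> nat) \<Rightarrow> (nat \<Rightarrow> 'a \<Rightarrow> nat \<Rightarrow> real) \<Rightarrow> (nat \<Rightarrow> (real^'m) set) \<Rightarrow>
   nat \<Rightarrow> (nat \<Rightarrow> nat \<Rightarrow> real^'m) \<Rightarrow> (nat \<Rightarrow> 'a) \<Rightarrow> (nat \<Rightarrow> real^'m) \<Rightarrow> bool" where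
  "optimal M T xbar f c cT n g U l F x u \<longleftrightarrow>
     admissible M T xbar f n g U l F x u \<and>
     (\<forall>x' u'. admissible M T xbar f n g U l F x' u' \<longrightarrow> total_cost T c cT x u \<le> total_cost T c cT x' u')"

end

theory Submission
  imports Defs "HOL-Probability.Discrete_Topology"
begin

text \<open>
  Eliminating the states makes the problem one in the controls alone. The cost, the active state
  constraints and the linear constraint have a first-order expansion in a control variation \<open>w\<close>,
  with the state variation \<open>response w\<close> in charts. If the image of the product of the tent cones
  under (functionals plus slack, linear constraint) is not the whole space, a separating functional
  gives the multipliers. Otherwise there is a \<open>w\<close> in the relative interior of the product cone that
  decreases the cost and the active constraints strictly, satisfies the linear constraint, and at
  which the linear constraint is onto; correcting \<open>us + s w\<close> by a contraction argument in the tent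
  parametrizations gives feasible controls \<open>us + s w + o(s)\<close> with smaller cost, contradicting
  optimality. Finally, solving the adjoint equation backwards turns the separation inequality,
  tested on variations supported at a single time, into the pointwise maximum condition.
\<close>

section \<open>Separation\<close>

text \<open>The control sets are arbitrary, so feasibility of a varied control is available only
  through the tent maps, which reproduce a variation up to \<open>o(s)\<close>. Strict inequalities
  absorb such an error; an equality does not. Repairing it needs directions \<open>V\<close> that
  may be added with either sign, and a base direction \<open>w\<close> in the relative interior
  allows this: after division by \<open>s\<close> the repair is small against the distance from
  \<open>w\<close> to the relative boundary. A tent map is continuously differentiable with identity
  derivative at its vertex, so it differs from the identity by a map of small Lipschitz constant;
  hence contraction suffices and no topological fixed point theorem is used. Since the dynamics are
  gone before the separation, no multiplier for them occurs there. This is why non-triviality can be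
  claimed for \<open>\<eta>x\<close>, \<open>\<eta>c\<close>, \<open>\<eta>u\<close> alone, the
  adjoint state being computed from these. Separating only over the constraints active on the
  optimal trajectory builds in complementary slackness. The numbers of constraints are not types, so
  separation and fixed points are both handled for functions on a finite index set.\<close>

text \<open>Here \<open>P y s\<close> plays the role of \<open>\<phi>(y) \<le> s\<close> for a sublinear \<open>\<phi>\<close>; the components of \<open>y\<close> outside
  \<open>I\<close> are irrelevant.\<close>

lemma sublinear_supporting_functional:
  fixes P :: "('i \<Rightarrow> real) \<Rightarrow> real \<Rightarrow> bool"
  assumes "finite I"
    and add: "\<And>y s y' s'. P y s \<Longrightarrow> P y' s' \<Longrightarrow> P (\<lambda>i. y i + y' i) (s + s')"
    and scale: "\<And>y s r. P y s \<Longrightarrow> r > 0 \<Longrightarrow> P (\<lambda>i. r * y i) (r * s)"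
    and onto: "\<And>z. \<exists>y s. P y s \<and> (\<forall>i\<in>I. y i = z i)"
    and nonneg: "\<And>y s. P y s \<Longrightarrow> (\<forall>i\<in>I. y i = 0) \<Longrightarrow> s \<ge> 0"
  shows "\<exists>a. \<forall>y s. P y s \<longrightarrow> (\<Sum>i\<in>I. a i * y i) \<le> s"
  using assms
proof (induction I arbitrary: P rule: finite_induct)
  case empty
  then show ?case by auto
next
  case (insert i I)
  note add = insert.prems(1) and scale = insert.prems(2) and onto = insert.prems(3)
    and nonneg = insert.prems(4)
  \<comment> \<open>The one-dimensional extension step of Hahn-Banach: a slope \<open>a\<close> for
    coordinate \<open>i\<close> is compatible with the bounds on vectors vanishing on
    \<open>I\<close> exactly when it lies above \<open>Lo\<close> and below \<open>Up\<close>.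
    Vectors with \<open>y i = -1\<close> give the lower bounds, hence the sign in
    \<open>P y (- s)\<close>.\<close>
  define Lo where "Lo = {s. \<exists>y. P y (- s) \<and> (\<forall>k\<in>I. y k = 0) \<and> y i = -1}"
  define Up where "Up = {s. \<exists>y. P y s \<and> (\<forall>k\<in>I. y k = 0) \<and> y i = 1}"
  have le: "s \<le> s'" if s: "s \<in> Lo" and s': "s' \<in> Up" for s s'
  proof -
    obtain y y' where "P y (- s)" "\<forall>k\<in>I. y k = 0" "y i = -1" "P y' s'" "\<forall>k\<in>I. y' k = 0" "y' i = 1"
      using s s' unfolding Lo_def Up_def by auto
    then show ?thesis using nonneg[OF add[of y "- s" y' s']] by auto
  qed
  obtain y s where "P y s" "\<forall>k\<in>insert i I. y k = (if k = i then 1 else 0)"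
    using onto[of "\<lambda>k. if k = i then 1 else 0"] by blast
  then have "s \<in> Up" using insert.hyps unfolding Up_def by force
  obtain y' s' where "P y' s'" "\<forall>k\<in>insert i I. y' k = (if k = i then -1 else 0)"
    using onto[of "\<lambda>k. if k = i then -1 else 0"] by blast
  then have "- s' \<in> Lo" using insert.hyps unfolding Lo_def by force
  define a where "a = Sup Lo"
  have "bdd_above Lo" using le \<open>s \<in> Up\<close> by (meson bdd_above.I)
  have lo: "r \<le> a" if "r \<in> Lo" for r
    unfolding a_def using that \<open>bdd_above Lo\<close> by (rule cSup_upper)
  have up: "a \<le> r" if "r \<in> Up" for r
    unfolding a_def using that le \<open>- s' \<in> Lo\<close> by (intro cSup_least) auto
  \<comment> \<open>Subtracting the part of the functional already chosen: \<open>P'\<close> stands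
    for \<phi>(y) - a * y i \<le> s. It is again sublinear, and the choice of \<open>a\<close> is
    precisely what keeps it nonnegative on vectors that vanish on \<open>I\<close>.\<close>
  define P' where "P' = (\<lambda>y s. P y (s + a * y i))"
  have "\<exists>b. \<forall>y s. P' y s \<longrightarrow> (\<Sum>k\<in>I. b k * y k) \<le> s"
  proof (rule insert.IH)
    fix y s y' s' assume "P' y s" "P' y' s'"
    then show "P' (\<lambda>i. y i + y' i) (s + s')"
      unfolding P'_def using add[of y "s + a * y i" y' "s' + a * y' i"] by (simp add: algebra_simps)
  next
    fix y s r assume "P' y s" "(r::real) > 0"
    then show "P' (\<lambda>i. r * y i) (r * s)"
      unfolding P'_def using scale[of y "s + a * y i" r] by (simp add: algebra_simps)
  next
    fix z
    obtain y s where "P y s" "\<forall>k\<in>insert i I. y k = z k" using onto by blast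
    then show "\<exists>y s. P' y s \<and> (\<forall>k\<in>I. y k = z k)"
      unfolding P'_def by (intro exI[of _ y] exI[of _ "s - a * y i"]) auto
  next
    fix y s assume "P' y s" and 0: "\<forall>k\<in>I. y k = 0"
    then have P: "P y (s + a * y i)" unfolding P'_def by simp
    consider "y i = 0" | "y i > 0" | "y i < 0" by linarith
    then show "0 \<le> s"
    proof cases
      case 1
      then show ?thesis using nonneg[OF P] 0 by auto
    next
      case 2
      have "(s + a * y i) / y i \<in> Up"
        unfolding Up_def using scale[OF P, of "1 / y i"] 2 0 by auto
      from up[OF this] show ?thesis using 2 by (simp add: field_simps)
    next
      case 3
      have "(s + a * y i) / y i \<in> Lo"
        unfolding Lo_def using scale[OF P, of "- 1 / y i"] 3 0 by (auto simp: field_simps)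
      from lo[OF this] show ?thesis using 3 by (simp add: field_simps)
    qed
  qed
  then obtain b where b: "\<And>y s. P' y s \<Longrightarrow> (\<Sum>k\<in>I. b k * y k) \<le> s" by blast
  have "(\<Sum>k\<in>insert i I. (b(i := a)) k * y k) \<le> s" if "P y s" for y s
  proof -
    have "(\<Sum>k\<in>I. (b(i := a)) k * y k) = (\<Sum>k\<in>I. b k * y k)"
      using insert.hyps by (intro sum.cong) auto
    moreover have "(\<Sum>k\<in>I. b k * y k) \<le> s - a * y i"
      using that by (intro b) (simp add: P'_def)
    ultimately show ?thesis using insert.hyps by simp
  qed
  then show ?case by blast
qed

text \<open>Induction on the coordinates. If the cone projects onto the coordinates in
  \<open>I\<close> but the new coordinate has a fixed sign over the zero fibre, then the infimum of
  that signed coordinate over each fibre is a finite sublinear function. A linear functional below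
  it, subtracted from the signed coordinate, separates.\<close>

lemma convex_cone_onto_or_separated:
  fixes C :: "('i \<Rightarrow> real) set"
  assumes "finite I"
    and add: "\<And>y y'. y \<in> C \<Longrightarrow> y' \<in> C \<Longrightarrow> (\<lambda>i. y i + y' i) \<in> C"
    and scale: "\<And>y r. y \<in> C \<Longrightarrow> r > 0 \<Longrightarrow> (\<lambda>i. r * y i) \<in> C"
    and zero: "(\<lambda>i. 0) \<in> C"
  shows "(\<forall>z. \<exists>y\<in>C. \<forall>i\<in>I. y i = z i) \<or>
    (\<exists>a. (\<exists>i\<in>I. a i \<noteq> 0) \<and> (\<forall>y\<in>C. (\<Sum>i\<in>I. a i * y i) \<ge> 0))"
  using \<open>finite I\<close>
proof (induction I rule: finite_induct)
  case empty
  then show ?case using zero by auto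
next
  case (insert i I)
  have separated: ?case
    if sgn: "\<sigma> \<noteq> 0" and onto: "\<forall>z. \<exists>y\<in>C. \<forall>k\<in>I. y k = z k"
      and nonneg: "\<And>y. y \<in> C \<Longrightarrow> \<forall>k\<in>I. y k = 0 \<Longrightarrow> \<sigma> * y i \<ge> 0" for \<sigma> :: real
  proof -
    have "\<exists>a. \<forall>y s. y \<in> C \<and> s = \<sigma> * y i \<longrightarrow> (\<Sum>k\<in>I. a k * y k) \<le> s"
    proof (rule sublinear_supporting_functional[where P = "\<lambda>y s. y \<in> C \<and> s = \<sigma> * y i"])
      show "\<exists>y s. (y \<in> C \<and> s = \<sigma> * y i) \<and> (\<forall>k\<in>I. y k = z k)" for z
        using onto by blast
    qed (use insert.hyps nonneg add scale in \<open>auto simp: algebra_simps\<close>)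
    then obtain a where a: "\<And>y. y \<in> C \<Longrightarrow> (\<Sum>k\<in>I. a k * y k) \<le> \<sigma> * y i" by blast
    define b where "b k = (if k = i then \<sigma> else - a k)" for k
    have "(\<Sum>k\<in>insert i I. b k * y k) \<ge> 0" if "y \<in> C" for y
    proof -
      have "(\<Sum>k\<in>I. b k * y k) = - (\<Sum>k\<in>I. a k * y k)"
        unfolding sum_negf[symmetric] using insert.hyps by (intro sum.cong) (auto simp: b_def)
      then show ?thesis using a[OF that] insert.hyps by (simp add: b_def)
    qed
    moreover have "b i \<noteq> 0" using sgn by (simp add: b_def)
    ultimately show ?thesis by blast
  qed
  show ?case
  proof (cases "\<exists>a. (\<exists>k\<in>I. a k \<noteq> 0) \<and> (\<forall>y\<in>C. (\<Sum>k\<in>I. a k * y k) \<ge> 0)")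
    case True
    then obtain a k where a: "k \<in> I" "a k \<noteq> 0" "\<And>y. y \<in> C \<Longrightarrow> (\<Sum>k\<in>I. a k * y k) \<ge> 0" by blast
    have "(\<Sum>k\<in>I. (a(i := 0)) k * y k) = (\<Sum>k\<in>I. a k * y k)" for y
      using insert.hyps by (intro sum.cong) auto
    then have "(\<Sum>k\<in>insert i I. (a(i := 0)) k * y k) \<ge> 0" if "y \<in> C" for y
      using a(3)[OF that] insert.hyps by simp
    moreover have "(a(i := 0)) k \<noteq> 0" using a insert.hyps by auto
    ultimately show ?thesis using a(1) by (metis insertCI)
  next
    case False
    then have onto: "\<forall>z. \<exists>y\<in>C. \<forall>k\<in>I. y k = z k" using insert.IH by blast
    \<comment> \<open>If coordinate \<open>i\<close> takes both signs over the zero fibre, a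
      multiple of one of the two witnesses corrects coordinate \<open>i\<close> of any preimage
      without disturbing \<open>I\<close>. Otherwise the sign is fixed and \<open>separated\<close>
      applies with \<sigma> = 1 or \<sigma> = -1.\<close>
    show ?thesis
    proof (cases "(\<exists>y\<in>C. (\<forall>k\<in>I. y k = 0) \<and> y i < 0) \<and> (\<exists>y\<in>C. (\<forall>k\<in>I. y k = 0) \<and> y i > 0)")
      case True
      then obtain y y' where y: "y \<in> C" "\<forall>k\<in>I. y k = 0" "y i < 0"
        and y': "y' \<in> C" "\<forall>k\<in>I. y' k = 0" "y' i > 0" by blast
      have "\<exists>y\<in>C. \<forall>k\<in>insert i I. y k = z k" for z
      proof -
        obtain v where v: "v \<in> C" "\<forall>k\<in>I. v k = z k" using onto by blast
        consider "v i = z i" | "v i < z i" | "v i > z i" by linarith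
        then show ?thesis
        proof cases
          case 1
          then show ?thesis using v by auto
        next
          case 2
          have "(\<lambda>k. v k + (z i - v i) / y' i * y' k) \<in> C"
            using 2 y' by (intro add scale v) auto
          then show ?thesis using 2 y' v by (intro bexI) auto
        next
          case 3
          have "(\<lambda>k. v k + (z i - v i) / y i * y k) \<in> C"
            using 3 y by (intro add scale v) (auto simp: divide_neg_neg)
          then show ?thesis using 3 y v by (intro bexI) auto
        qed
      qed
      then show ?thesis by blast
    next
      case False
      then consider "\<And>y. y \<in> C \<Longrightarrow> \<forall>k\<in>I. y k = 0 \<Longrightarrow> 1 * y i \<ge> 0"
        | "\<And>y. y \<in> C \<Longrightarrow> \<forall>k\<in>I. y k = 0 \<Longrightarrow> -1 * y i \<ge> 0" by force
      then show ?thesis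
        using separated[of 1] separated[of "-1"] onto by cases auto
    qed
  qed
qed

section \<open>Convex cones and the alternative between multipliers and a descent direction\<close>

text \<open>The midpoint of a point of \<open>K\<close> and a relative interior point is relatively
  interior, and positive dilations of a cone preserve its relative interior; the sum is twice the
  midpoint of \<open>x\<close> and \<open>r *\<^sub>R y\<close>.\<close>

lemma rel_interior_convex_cone_add:
  fixes K :: "'a::euclidean_space set"
  assumes "convex K" "cone K" "x \<in> K" "y \<in> rel_interior K" "r > 0"
  shows "x + r *\<^sub>R y \<in> rel_interior K"
proof -
  have cone_rel: "s *\<^sub>R z \<in> rel_interior K" if "s > 0" "z \<in> rel_interior K" for s z
  proof -
    have "(*\<^sub>R) s ` K = K"
    proof
      show "(*\<^sub>R) s ` K \<subseteq> K" using assms(2) that by (auto simp: cone_def)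
      show "K \<subseteq> (*\<^sub>R) s ` K"
      proof
        fix v assume "v \<in> K"
        then have "(1 / s) *\<^sub>R v \<in> K" using assms(2) that by (auto simp: cone_def)
        then show "v \<in> (*\<^sub>R) s ` K" using that by (intro image_eqI[of _ _ "(1 / s) *\<^sub>R v"]) auto
      qed
    qed
    then show ?thesis using rel_interior_scaleR[of s K] that by force
  qed
  have "r *\<^sub>R y \<in> rel_interior K" using cone_rel assms by simp
  then have "x - (1 / 2) *\<^sub>R (x - r *\<^sub>R y) \<in> rel_interior K"
    using assms closure_subset[of K] by (intro rel_interior_closure_convex_shrink[OF \<open>convex K\<close>]) auto
  then have "2 *\<^sub>R (x - (1 / 2) *\<^sub>R (x - r *\<^sub>R y)) \<in> rel_interior K"
    by (intro cone_rel) auto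
  then show ?thesis by (simp add: algebra_simps scaleR_2)
qed

text \<open>The second outcome supplies more than \<open>w\<close>: the \<open>V k\<close> are
  preimages of the unit vectors under the linear constraint, taken inside the cones, and serve later
  as correction directions.\<close>

lemma multipliers_or_descent_direction:
  fixes K :: "nat \<Rightarrow> 'e::euclidean_space set" and p :: "'i \<Rightarrow> (nat \<Rightarrow> 'e) \<Rightarrow> real"
    and L :: "'j \<Rightarrow> (nat \<Rightarrow> 'e) \<Rightarrow> real"
  assumes "finite I" and "finite R"
    and K: "\<And>t. t < T \<Longrightarrow> convex (K t) \<and> cone (K t) \<and> K t \<noteq> {}"
    and p: "\<And>i a b v w. i \<in> I \<Longrightarrow> p i (\<lambda>t. a *\<^sub>R v t + b *\<^sub>R w t) = a * p i v + b * p i w"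
    and L: "\<And>j a b v w. j \<in> R \<Longrightarrow> L j (\<lambda>t. a *\<^sub>R v t + b *\<^sub>R w t) = a * L j v + b * L j w"
  obtains (multipliers) \<nu> \<mu> where "\<And>i. i \<in> I \<Longrightarrow> \<nu> i \<ge> 0"
      "(\<exists>i\<in>I. \<nu> i \<noteq> 0) \<or> (\<exists>j\<in>R. \<mu> j \<noteq> 0)"
      "\<And>w. (\<And>t. t < T \<Longrightarrow> w t \<in> K t) \<Longrightarrow> (\<Sum>j\<in>R. \<mu> j * L j w) \<le> (\<Sum>i\<in>I. \<nu> i * p i w)"
  | (direction) w V where "\<And>t. t < T \<Longrightarrow> w t \<in> rel_interior (K t)"
      "\<And>i. i \<in> I \<Longrightarrow> p i w < 0" "\<And>j. j \<in> R \<Longrightarrow> L j w = 0"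
      "\<And>t j. t < T \<Longrightarrow> V j t \<in> K t"
      "\<And>j k. j \<in> R \<Longrightarrow> L j (V k) = (if j = k then 1 else 0)"
proof -
  \<comment> \<open>Slack is added upwards in the \<open>Inl\<close> coordinates only. Pure slack
    therefore belongs to \<open>C\<close>, which forces nonnegative coefficients there, while the
    coefficients of the equalities may have either sign.\<close>
  define C where "C = {c :: 'i + 'j \<Rightarrow> real. \<exists>w. (\<forall>t<T. w t \<in> K t) \<and>
    (\<forall>i\<in>I. p i w \<le> c (Inl i)) \<and> (\<forall>j\<in>R. L j w = c (Inr j))}"
  define J where "J = Inl ` I \<union> Inr ` R"
  have K0: "0 \<in> K t" if "t < T" for t using K[OF that] cone_contains_0 by blast
  have Kadd: "x + r *\<^sub>R y \<in> K t" if "t < T" "x \<in> K t" "y \<in> K t" "r \<ge> 0" for t x y r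
    using K[OF that(1)] that convex_cone[of "K t"] by (metis cone_def)
  have p0: "p i (\<lambda>t. 0) = 0" if "i \<in> I" for i using p[OF that, of 0 "\<lambda>t. 0" 0 "\<lambda>t. 0"] by simp
  have L0: "L j (\<lambda>t. 0) = 0" if "j \<in> R" for j using L[OF that, of 0 "\<lambda>t. 0" 0 "\<lambda>t. 0"] by simp
  have pC: "p i (\<lambda>t. v t + r *\<^sub>R w t) = p i v + r * p i w" if "i \<in> I" for i v w r
    using p[OF that, of 1 v r w] by simp
  have LC: "L j (\<lambda>t. v t + r *\<^sub>R w t) = L j v + r * L j w" if "j \<in> R" for j v w r
    using L[OF that, of 1 v r w] by simp
  have pS: "p i (\<lambda>t. r *\<^sub>R w t) = r * p i w" if "i \<in> I" for i r w
    using p[OF that, of r w 0 w] by simp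
  have LS: "L j (\<lambda>t. r *\<^sub>R w t) = r * L j w" if "j \<in> R" for j r w
    using L[OF that, of r w 0 w] by simp
  have CD: "\<exists>w. (\<forall>t<T. w t \<in> K t) \<and> (\<forall>i\<in>I. p i w \<le> c (Inl i)) \<and> (\<forall>j\<in>R. L j w = c (Inr j))"
    if "c \<in> C" for c using that unfolding C_def by simp
  have "finite J" using \<open>finite I\<close> \<open>finite R\<close> by (simp add: J_def)
  moreover have "(\<lambda>i. y i + y' i) \<in> C" if y: "y \<in> C" "y' \<in> C" for y y'
  proof -
    obtain w where "\<forall>t<T. w t \<in> K t" "\<forall>i\<in>I. p i w \<le> y (Inl i)" "\<forall>j\<in>R. L j w = y (Inr j)"
      using CD[OF y(1)] by blast
    moreover obtain w' where "\<forall>t<T. w' t \<in> K t" "\<forall>i\<in>I. p i w' \<le> y' (Inl i)" "\<forall>j\<in>R. L j w' = y' (Inr j)"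
      using CD[OF y(2)] by blast
    ultimately show ?thesis unfolding C_def using Kadd pC LC
      by (intro CollectI exI[of _ "\<lambda>t. w t + 1 *\<^sub>R w' t"]) (auto simp: add_mono simp del: scaleR_one)
  qed
  moreover have "(\<lambda>i. r * y i) \<in> C" if y: "y \<in> C" "r > 0" for y r
  proof -
    obtain w where "\<forall>t<T. w t \<in> K t" "\<forall>i\<in>I. p i w \<le> y (Inl i)" "\<forall>j\<in>R. L j w = y (Inr j)"
      using CD[OF y(1)] by blast
    then show ?thesis unfolding C_def using K pS LS y
      by (intro CollectI exI[of _ "\<lambda>t. r *\<^sub>R w t"]) (auto simp: mult_left_mono cone_def)
  qed
  moreover have Cpos: "y \<in> C" if "\<And>i. i \<in> I \<Longrightarrow> y (Inl i) \<ge> 0" "\<And>j. j \<in> R \<Longrightarrow> y (Inr j) = 0" for y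
    unfolding C_def using that p0 L0 K0 by (intro CollectI exI[of _ "\<lambda>t. 0"]) auto
  ultimately consider (onto) "\<forall>z. \<exists>y\<in>C. \<forall>i\<in>J. y i = z i"
    | (sep) "\<exists>a. (\<exists>i\<in>J. a i \<noteq> 0) \<and> (\<forall>y\<in>C. (\<Sum>i\<in>J. a i * y i) \<ge> 0)"
    using convex_cone_onto_or_separated[of J C] by auto
  then show thesis
  proof cases
    case sep
    then obtain a where a: "\<exists>i\<in>J. a i \<noteq> 0" "\<And>y. y \<in> C \<Longrightarrow> (\<Sum>i\<in>J. a i * y i) \<ge> 0" by blast
    have sumJ: "(\<Sum>i\<in>J. h i) = (\<Sum>i\<in>I. h (Inl i)) + (\<Sum>j\<in>R. h (Inr j))" for h :: "_ \<Rightarrow> real"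
      unfolding J_def using \<open>finite I\<close> \<open>finite R\<close>
      by (subst sum.union_disjoint) (auto simp: sum.reindex o_def)
    \<comment> \<open>The coefficients on \<open>Inr\<close> change sign because the equality terms
      move to the other side of the inequality.\<close>
    show thesis
    proof (rule multipliers[of "\<lambda>i. a (Inl i)" "\<lambda>j. - a (Inr j)"])
      fix i assume "i \<in> I"
      have "(\<lambda>k. if k = Inl i then 1 else 0) \<in> C" by (rule Cpos) auto
      from a(2)[OF this] show "a (Inl i) \<ge> 0"
        using \<open>i \<in> I\<close> \<open>finite J\<close> by (simp add: J_def if_distrib sum.delta cong: if_cong)
    next
      show "(\<exists>i\<in>I. a (Inl i) \<noteq> 0) \<or> (\<exists>j\<in>R. - a (Inr j) \<noteq> 0)" using a(1) by (auto simp: J_def)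
    next
      fix w assume "\<And>t. t < T \<Longrightarrow> w t \<in> K t"
      then have "case_sum (\<lambda>i. p i w) (\<lambda>j. L j w) \<in> C"
        unfolding C_def by auto
      from a(2)[OF this] show "(\<Sum>j\<in>R. - a (Inr j) * L j w) \<le> (\<Sum>i\<in>I. a (Inl i) * p i w)"
        by (simp add: sumJ sum_negf)
    qed
  next
    case onto
    have ex: "\<exists>w. (\<forall>t<T. w t \<in> K t) \<and> (\<forall>i\<in>I. p i w \<le> \<alpha>) \<and> (\<forall>j\<in>R. L j w = \<beta> j)" for \<alpha> \<beta>
    proof -
      obtain y where "y \<in> C" "\<forall>i\<in>J. y i = case_sum (\<lambda>i. \<alpha>) \<beta> i" using onto by blast
      then show ?thesis unfolding C_def J_def by auto
    qed
    \<comment> \<open>The point \<open>w1\<close> decreases every functional but may lie on the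
      relative boundary. It is pushed inside by a small multiple of \<open>w0\<close>, which is
      relatively interior and satisfies the linear constraint because \<open>w2\<close> cancels the
      values of \<open>L\<close> at an arbitrary relative interior point \<open>z\<close>.\<close>
    have "\<forall>t. \<exists>x. t < T \<longrightarrow> x \<in> rel_interior (K t)"
      using K rel_interior_eq_empty by blast
    then obtain z where z: "\<And>t. t < T \<Longrightarrow> z t \<in> rel_interior (K t)" by metis
    obtain w1 where w1: "\<forall>t<T. w1 t \<in> K t" "\<forall>i\<in>I. p i w1 \<le> -1" "\<forall>j\<in>R. L j w1 = 0"
      using ex[of "-1" "\<lambda>j. 0"] by blast
    obtain w2 where w2: "\<forall>t<T. w2 t \<in> K t" "\<forall>j\<in>R. L j w2 = - L j z"
      using ex[of 0 "\<lambda>j. - L j z"] by blast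
    define w0 where "w0 = (\<lambda>t. w2 t + 1 *\<^sub>R z t)"
    have w0: "w0 t \<in> rel_interior (K t)" if "t < T" for t
      unfolding w0_def using K[OF that] w2 z that by (intro rel_interior_convex_cone_add) auto
    have Lw0: "L j w0 = 0" if "j \<in> R" for j unfolding w0_def using LC[OF that, of w2 1 z] w2 that by auto
    \<comment> \<open>Large enough that \<open>(1 / m) *\<^sub>R w0\<close> raises each functional
      by less than the decrease of at least 1 provided by \<open>w1\<close>.\<close>
    define m where "m = (\<Sum>i\<in>I. \<bar>p i w0\<bar>) + 1"
    have m: "m > 0" "\<And>i. i \<in> I \<Longrightarrow> p i w0 < m"
    proof -
      show "m > 0" unfolding m_def by (smt (verit) sum_nonneg abs_ge_zero)
      show "p i w0 < m" if "i \<in> I" for i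
        using member_le_sum[OF that, of "\<lambda>i. \<bar>p i w0\<bar>"] \<open>finite I\<close> unfolding m_def by simp
    qed
    have "\<forall>k. \<exists>w. (\<forall>t<T. w t \<in> K t) \<and> (\<forall>j\<in>R. L j w = (if j = k then 1 else 0))"
    proof
      show "\<exists>w. (\<forall>t<T. w t \<in> K t) \<and> (\<forall>j\<in>R. L j w = (if j = k then 1 else 0))" for k
        using ex[of 0 "\<lambda>j. if j = k then 1 else 0"] by blast
    qed
    then obtain V where V: "\<And>k. (\<forall>t<T. V k t \<in> K t) \<and> (\<forall>j\<in>R. L j (V k) = (if j = k then 1 else 0))"
      by metis
    show thesis
    proof (rule direction[of "\<lambda>t. w1 t + (1 / m) *\<^sub>R w0 t" V])
      show "w1 t + (1 / m) *\<^sub>R w0 t \<in> rel_interior (K t)" if "t < T" for t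
        using K[OF that] w1 w0 that m by (intro rel_interior_convex_cone_add) auto
      show "p i (\<lambda>t. w1 t + (1 / m) *\<^sub>R w0 t) < 0" if "i \<in> I" for i
      proof -
        have "(1 / m) * p i w0 < 1" using m that by (simp add: field_simps)
        then show ?thesis using pC[OF that, of w1 "1 / m" w0] w1 that by force
      qed
      show "L j (\<lambda>t. w1 t + (1 / m) *\<^sub>R w0 t) = 0" if "j \<in> R" for j
        using LC[OF that, of w1 "1 / m" w0] w1 Lw0 that by auto
    qed (use V in auto)
  qed
qed

section \<open>Feasible control curves\<close>

lemma finite_common_radius:
  fixes P :: "'i \<Rightarrow> real \<Rightarrow> bool"
  assumes "finite I" and "\<And>i. i \<in> I \<Longrightarrow> \<exists>d>0. P i d"
    and "\<And>i d d'. P i d \<Longrightarrow> 0 < d' \<Longrightarrow> d' \<le> d \<Longrightarrow> P i d'"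
  shows "\<exists>d>0. \<forall>i\<in>I. P i d"
  using assms(1,2)
proof (induction I rule: finite_induct)
  case empty
  then show ?case by (auto intro: exI[of _ 1])
next
  case (insert i I)
  then obtain d d' where "d > 0" "\<forall>i\<in>I. P i d" "d' > 0" "P i d'" by force
  then show ?case using assms(3) by (intro exI[of _ "min d d'"]) (auto intro: assms(3))
qed

text \<open>The little-o condition gives only the value and the derivative of \<open>\<phi>\<close>
  at the vertex, and bounds on sizes. The contraction needs bounds on differences; these come from
  continuity of the derivative and the mean value inequality.\<close>

lemma tent_near_identity:
  assumes "tent \<Omega> z0 Q"
  obtains \<phi> \<epsilon> where "\<phi> z0 = z0" "\<epsilon> > 0" "\<And>z. z \<in> Q \<Longrightarrow> norm (z - z0) < \<epsilon> \<Longrightarrow> \<phi> z \<in> \<Omega>"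
    "\<And>e. e > 0 \<Longrightarrow> \<exists>r>0. \<forall>z\<in>ball z0 r. \<forall>z'\<in>ball z0 r. norm ((\<phi> z - z) - (\<phi> z' - z')) \<le> e * norm (z - z')"
proof -
  obtain \<phi> N \<epsilon> where N: "open N" "z0 \<in> N" and sm: "smooth_on N \<phi>"
    and o: "(\<lambda>z. norm (\<phi> z - z)) \<in> o[nhds z0](\<lambda>z. norm (z - z0))"
    and \<epsilon>: "\<epsilon> > 0" "\<forall>z\<in>Q. norm (z - z0) < \<epsilon> \<longrightarrow> z \<in> N \<and> \<phi> z \<in> \<Omega>"
    using assms unfolding tent_def by blast
  have small: "\<forall>\<^sub>F z in nhds z0. norm (\<phi> z - z) \<le> e * norm (z - z0)" if "e > 0" for e
    using landau_o.smallD[OF o that] by simp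
  have \<phi>0: "\<phi> z0 = z0" using eventually_nhds_x_imp_x[OF small[of 1]] by simp
  have "Ck_on (Suc 0) N \<phi>" using sm unfolding smooth_on_def by blast
  then have diff: "\<phi> differentiable_on N"
    and cont: "\<And>v. continuous_on N (\<lambda>x. frechet_derivative \<phi> (at x) v)" by simp_all
  have D: "(\<phi> has_derivative frechet_derivative \<phi> (at z)) (at z)" if "z \<in> N" for z
    using diff N(1) that differentiable_on_eq_differentiable_at frechet_derivative_works by blast
  have "(\<phi> has_derivative (\<lambda>v. v)) (at z0)"
    unfolding has_derivative_at_alt
  proof (intro conjI allI impI)
    fix e :: real assume "e > 0"
    from small[OF this] obtain d where "d > 0" "\<forall>z. dist z z0 < d \<longrightarrow> norm (\<phi> z - z) \<le> e * norm (z - z0)"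
      unfolding eventually_nhds_metric by blast
    then show "\<exists>d>0. \<forall>z. norm (z - z0) < d \<longrightarrow> norm (\<phi> z - \<phi> z0 - (z - z0)) \<le> e * norm (z - z0)"
      using \<phi>0 by (auto simp: dist_norm)
  qed (rule bounded_linear_ident)
  then have D0: "frechet_derivative \<phi> (at z0) = (\<lambda>v. v)" using frechet_derivative_at by metis
  have "\<exists>r>0. \<forall>z\<in>ball z0 r. \<forall>z'\<in>ball z0 r. norm ((\<phi> z - z) - (\<phi> z' - z')) \<le> e * norm (z - z')"
    if "e > 0" for e
  proof -
    \<comment> \<open>Continuity of the derivative is known direction by direction. Summing over the
      basis bounds the operator norm at the cost of a factor equal to the dimension.\<close>
    define e' where "e' = e / real DIM('a)"
    have "e' > 0" using that by (simp add: e'_def)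
    have "\<exists>r>0. \<forall>b\<in>Basis. \<forall>z\<in>ball z0 r. z \<in> N \<and> norm (frechet_derivative \<phi> (at z) b - b) \<le> e'"
    proof (rule finite_common_radius)
      fix b :: 'a assume "b \<in> Basis"
      have "isCont (\<lambda>x. frechet_derivative \<phi> (at x) b) z0"
        using cont N by (simp add: continuous_on_eq_continuous_at)
      then have "((\<lambda>x. frechet_derivative \<phi> (at x) b) \<longlongrightarrow> b) (nhds z0)"
        using D0 by (metis isCont_def tendsto_at_iff_tendsto_nhds)
      then have "\<forall>\<^sub>F z in nhds z0. dist (frechet_derivative \<phi> (at z) b) b < e'"
        using \<open>e' > 0\<close> by (rule tendstoD)
      moreover have "\<forall>\<^sub>F z in nhds z0. z \<in> N" using N by (rule eventually_nhds_in_open)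
      ultimately have "\<forall>\<^sub>F z in nhds z0. z \<in> N \<and> norm (frechet_derivative \<phi> (at z) b - b) \<le> e'"
        by eventually_elim (auto simp: dist_norm)
      then show "\<exists>r>0. \<forall>z\<in>ball z0 r. z \<in> N \<and> norm (frechet_derivative \<phi> (at z) b - b) \<le> e'"
        unfolding eventually_nhds_metric by (auto simp: dist_commute)
    qed auto
    then obtain r where r: "r > 0" "\<And>z. z \<in> ball z0 r \<Longrightarrow> z \<in> N"
      "\<And>z b. z \<in> ball z0 r \<Longrightarrow> b \<in> Basis \<Longrightarrow> norm (frechet_derivative \<phi> (at z) b - b) \<le> e'"
      using nonempty_Basis by (metis (no_types, lifting) all_not_in_conv)
    have "norm ((\<phi> z - z) - (\<phi> z' - z')) \<le> e * norm (z - z')" if z: "z \<in> ball z0 r" "z' \<in> ball z0 r" for z z'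
    proof (rule differentiable_bound[of "ball z0 r" _ "\<lambda>z v. frechet_derivative \<phi> (at z) v - v"])
      fix y assume y: "y \<in> ball z0 r"
      show "((\<lambda>z. \<phi> z - z) has_derivative (\<lambda>v. frechet_derivative \<phi> (at y) v - v)) (at y within ball z0 r)"
        using D[OF r(2)[OF y]] by (auto intro!: derivative_eq_intros dest: has_derivative_at_withinI)
      have lin: "linear (\<lambda>v. frechet_derivative \<phi> (at y) v - v)"
        using D[OF r(2)[OF y]] by (intro linear_compose_sub linear_id[unfolded id_def])
          (auto dest: has_derivative_linear)
      show "onorm (\<lambda>v. frechet_derivative \<phi> (at y) v - v) \<le> e"
      proof (rule onorm_bound)
        fix v :: 'a
        have "frechet_derivative \<phi> (at y) v - v
            = (\<Sum>b\<in>Basis. (v \<bullet> b) *\<^sub>R (frechet_derivative \<phi> (at y) b - b))"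
          using linear_sum[OF lin, of "\<lambda>b. (v \<bullet> b) *\<^sub>R b" Basis]
          by (simp add: euclidean_representation linear_scale[OF lin])
        also have "norm \<dots> \<le> (\<Sum>b\<in>(Basis :: 'a set). norm v * e')"
          using r(3)[OF y] Basis_le_norm
          by (intro sum_norm_le) (auto intro!: mult_mono)
        also have "\<dots> = e * norm v" by (simp add: e'_def)
        finally show "norm (frechet_derivative \<phi> (at y) v - v) \<le> e * norm v" .
      qed (use \<open>e > 0\<close> in simp)
    qed (use z in auto)
    then show ?thesis using r(1) by blast
  qed
  then show thesis using that \<phi>0 \<epsilon> by blast
qed

section \<open>Correcting the linear constraint by contraction\<close>

lemma small_perturbation_of_identity_has_zero:
  fixes R :: "('i \<Rightarrow> real) \<Rightarrow> 'i \<Rightarrow> real"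
  assumes "finite J" "\<rho> \<ge> 0"
    and lip: "\<And>y y' d j. (\<And>k. \<bar>y k\<bar> \<le> \<rho>) \<Longrightarrow> (\<And>k. \<bar>y' k\<bar> \<le> \<rho>) \<Longrightarrow> (\<And>k. \<bar>y k - y' k\<bar> \<le> d) \<Longrightarrow> j \<in> J \<Longrightarrow>
      \<bar>R y j - R y' j\<bar> \<le> d / 2"
    and zero: "\<And>j. j \<in> J \<Longrightarrow> \<bar>R (\<lambda>_. 0) j\<bar> \<le> \<rho> / 2"
  shows "\<exists>y. (\<forall>j. \<bar>y j\<bar> \<le> \<rho>) \<and> (\<forall>j\<in>J. y j + R y j = 0)"
  \<comment> \<open>Banach's theorem on the sup-norm space of functions on the discrete space of indices,
    because the number of equations is not a type\<close>
proof -
  define val where "val y j = apply_bcontfun y (discrete j)" for y :: "'i discrete \<Rightarrow>\<^sub>C real" and j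
  \<comment> \<open>A fixed point of \<open>G\<close> solves the equations. The value 0 outside
    \<open>J\<close> makes the range finite, hence bounded; continuity is automatic on a discrete
    space.\<close>
  define G :: "('i discrete \<Rightarrow>\<^sub>C real) \<Rightarrow> ('i discrete \<Rightarrow>\<^sub>C real)"
    where "G y = Bcontfun (\<lambda>j. if of_discrete j \<in> J then - R (val y) (of_discrete j) else 0)" for y
  have G: "apply_bcontfun (G y) j = (if of_discrete j \<in> J then - R (val y) (of_discrete j) else 0)" for y j
  proof -
    have "finite (range (\<lambda>j. if of_discrete j \<in> J then - R (val y) (of_discrete j) else 0))"
      by (rule finite_subset[of _ "insert 0 ((\<lambda>j. - R (val y) j) ` J)"]) (use \<open>finite J\<close> in auto)
    from finite_imp_bounded[OF this]
    have "(\<lambda>j. if of_discrete j \<in> J then - R (val y) (of_discrete j) else 0) \<in> bcontfun"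
      unfolding bcontfun_def
      by (intro CollectI conjI) (simp_all add: continuous_on_open_vimage Discrete_Topology.open_discrete)
    then show ?thesis unfolding G_def by (simp add: Bcontfun_inverse)
  qed
  have le: "\<bar>val y j\<bar> \<le> \<rho>" if "y \<in> cball 0 \<rho>" for y j
    using that norm_bounded[of y "discrete j"] by (simp add: val_def)
  have val_dist: "\<bar>val y j - val y' j\<bar> \<le> dist y y'" for y y' j
    using dist_bounded[of y "discrete j" y'] by (simp add: val_def dist_real_def)
  have val0: "val 0 = (\<lambda>_. 0)" by (simp add: val_def fun_eq_iff zero_bcontfun.rep_eq)
  have "\<exists>!y\<in>cball 0 \<rho>. G y = y"
  proof (rule Banach_fix[of _ "1 / 2"])
    show dist: "dist (G y) (G y') \<le> 1 / 2 * dist y y'" if y: "y \<in> cball 0 \<rho>" "y' \<in> cball 0 \<rho>" for y y'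
    proof (rule dist_bound)
      fix j
      have "\<bar>R (val y) k - R (val y') k\<bar> \<le> dist y y' / 2" if "k \<in> J" for k
        using lip[of "val y" "val y'" "dist y y'" k] le[OF y(1)] le[OF y(2)] that val_dist by blast
      then show "dist (G y j) (G y' j) \<le> 1 / 2 * dist y y'"
        by (simp add: G dist_real_def abs_minus_commute)
    qed
    show "G ` cball 0 \<rho> \<subseteq> cball 0 \<rho>"
    proof clarify
      fix y :: "'i discrete \<Rightarrow>\<^sub>C real" assume y: "y \<in> cball 0 \<rho>"
      \<comment> \<open>The ball is mapped to itself: half of the radius accounts for
        \<open>G 0\<close>, the other half for the contraction factor.\<close>
      have "norm (G 0) \<le> \<rho> / 2"
        using zero \<open>\<rho> \<ge> 0\<close> by (intro norm_bound) (auto simp: G val0)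
      moreover have "dist (G y) (G 0) \<le> \<rho> / 2"
        using dist[OF y, of 0] y \<open>\<rho> \<ge> 0\<close> by simp
      ultimately show "G y \<in> cball 0 \<rho>"
        using dist_triangle[of "G y" 0 "G 0"] by (simp add: dist_commute)
    qed
  qed (use \<open>\<rho> \<ge> 0\<close> in \<open>auto simp: complete_eq_closed\<close>)
  then obtain y where y: "y \<in> cball 0 \<rho>" "G y = y" by blast
  have "val y j + R (val y) j = 0" if "j \<in> J" for j
    using G[of y "discrete j"] y(2) that by (simp add: val_def discrete_inverse)
  then show ?thesis using le[OF y(1)] by blast
qed

text \<open>The coefficients may be negative, so convexity is no help. Instead the combination stays
  in the affine hull, and near a relative interior point the affine hull lies inside
  \<open>Q\<close>.\<close>

lemma rel_interior_contains_combination: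
  fixes Q :: "'a::euclidean_space set"
  assumes "z0 + w \<in> rel_interior Q" "z0 \<in> affine hull Q"
    and "finite J" "\<And>j. j \<in> J \<Longrightarrow> z0 + V j \<in> affine hull Q"
  shows "\<exists>d>0. \<forall>c :: 'j \<Rightarrow> real. norm (\<Sum>j\<in>J. c j *\<^sub>R V j) < d \<longrightarrow> z0 + w + (\<Sum>j\<in>J. c j *\<^sub>R V j) \<in> Q"
proof -
  obtain d where d: "d > 0" "ball (z0 + w) d \<inter> affine hull Q \<subseteq> Q"
    using assms(1) by (auto simp: mem_rel_interior_ball)
  have "w \<in> {y. z0 + y \<in> affine hull Q}"
    using assms(1) rel_interior_subset hull_subset[of Q affine] by blast
  moreover have sub: "subspace {y. z0 + y \<in> affine hull Q}"
  proof -
    have "{y. z0 + y \<in> affine hull Q} = (\<lambda>x. (- z0) + x) ` (affine hull Q)"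
      by (auto intro!: image_eqI[of _ _ "z0 + _"])
    then show ?thesis using affine_diffs_subspace[OF affine_affine_hull assms(2)] by simp
  qed
  ultimately have "w + (\<Sum>j\<in>J. c j *\<^sub>R V j) \<in> {y. z0 + y \<in> affine hull Q}" for c
    using assms(4) by (intro subspace_add subspace_sum subspace_scale) auto
  then have "z0 + w + (\<Sum>j\<in>J. c j *\<^sub>R V j) \<in> affine hull Q" for c by (simp add: add.assoc)
  moreover have "z0 + w + (\<Sum>j\<in>J. c j *\<^sub>R V j) \<in> ball (z0 + w) d"
    if "norm (\<Sum>j\<in>J. c j *\<^sub>R V j) < d" for c
    using that by (simp add: dist_norm)
  ultimately show ?thesis using d by blast
qed

text \<open>With controls \<open>\<phi> t (us t + s w t + \<Sum>j y j V j t)\<close>, the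
  biorthogonality \<open>LV\<close> turns the linear constraint into \<open>y + R s y = 0\<close>,
  where \<open>R\<close> collects only the error of \<open>\<phi>\<close> against the identity. This
  is solved with \<open>y\<close> of size at most \<open>s * \<delta>\<close>, which keeps the
  argument in the cone; the equation itself then shows that \<open>y\<close> is \<open>o(s)\<close>,
  so the velocity remains \<open>w\<close>.\<close>

lemma feasible_control_curve:
  fixes us w :: "nat \<Rightarrow> 'e::euclidean_space" and F V :: "nat \<Rightarrow> nat \<Rightarrow> 'e"
  assumes tent: "\<And>t. t < T \<Longrightarrow> tent (U t) (us t) (Q t)"
    and w: "\<And>t. t < T \<Longrightarrow> us t + w t \<in> rel_interior (Q t)"
    and V: "\<And>t j. t < T \<Longrightarrow> j \<in> J \<Longrightarrow> us t + V j t \<in> affine hull (Q t)"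
    and "finite J"
    and Lus: "\<And>j. j \<in> J \<Longrightarrow> (\<Sum>t<T. F t j \<bullet> us t) = 0"
    and Lw: "\<And>j. j \<in> J \<Longrightarrow> (\<Sum>t<T. F t j \<bullet> w t) = 0"
    and LV: "\<And>j k. j \<in> J \<Longrightarrow> k \<in> J \<Longrightarrow> (\<Sum>t<T. F t j \<bullet> V k t) = (if j = k then 1 else 0)"
  obtains u :: "real \<Rightarrow> nat \<Rightarrow> 'e" where "u 0 = us"
    "\<And>t. t < T \<Longrightarrow> ((\<lambda>s. u s t) has_vector_derivative w t) (at 0 within {0..})"
    "\<forall>\<^sub>F s in at_right 0. (\<forall>t<T. u s t \<in> U t) \<and> (\<forall>j\<in>J. (\<Sum>t<T. F t j \<bullet> u s t) = 0)"
proof -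
  have "\<forall>t. \<exists>\<phi> \<epsilon>. t < T \<longrightarrow> \<phi> (us t) = us t \<and> \<epsilon> > 0 \<and>
      (\<forall>z\<in>Q t. norm (z - us t) < \<epsilon> \<longrightarrow> \<phi> z \<in> U t) \<and>
      (\<forall>e>0. \<exists>r>0. \<forall>z\<in>ball (us t) r. \<forall>z'\<in>ball (us t) r. norm ((\<phi> z - z) - (\<phi> z' - z')) \<le> e * norm (z - z'))"
    using tent_near_identity[OF tent] by metis
  then obtain \<phi> \<epsilon> where all: "\<forall>t. t < T \<longrightarrow> \<phi> t (us t) = us t \<and> \<epsilon> t > 0 \<and>
      (\<forall>z\<in>Q t. norm (z - us t) < \<epsilon> t \<longrightarrow> \<phi> t z \<in> U t) \<and>
      (\<forall>e>0. \<exists>r>0. \<forall>z\<in>ball (us t) r. \<forall>z'\<in>ball (us t) r.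
        norm ((\<phi> t z - z) - (\<phi> t z' - z')) \<le> e * norm (z - z'))"
    unfolding choice_iff by blast
  have \<phi>0: "\<And>t. t < T \<Longrightarrow> \<phi> t (us t) = us t"
    and \<epsilon>: "\<And>t. t < T \<Longrightarrow> \<epsilon> t > 0" "\<And>t z. t < T \<Longrightarrow> z \<in> Q t \<Longrightarrow> norm (z - us t) < \<epsilon> t \<Longrightarrow> \<phi> t z \<in> U t"
    and lip: "\<And>t e. t < T \<Longrightarrow> e > 0 \<Longrightarrow>
      \<exists>r>0. \<forall>z\<in>ball (us t) r. \<forall>z'\<in>ball (us t) r. norm ((\<phi> t z - z) - (\<phi> t z' - z')) \<le> e * norm (z - z')"
    using all by blast+
  define \<psi> where "\<psi> t z = \<phi> t z - z" for t z
  have \<psi>0: "\<psi> t (us t) = 0" if "t < T" for t using \<phi>0[OF that] by (simp add: \<psi>_def)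
  have lip': "\<exists>r>0. \<forall>t\<in>{..<T}. \<forall>z\<in>ball (us t) r. \<forall>z'\<in>ball (us t) r. norm (\<psi> t z - \<psi> t z') \<le> e * norm (z - z')"
    if "e > 0" for e
  proof (rule finite_common_radius)
    show "\<exists>d>0. \<forall>z\<in>ball (us t) d. \<forall>z'\<in>ball (us t) d. norm (\<psi> t z - \<psi> t z') \<le> e * norm (z - z')"
      if "t \<in> {..<T}" for t
      using lip[of t e] that \<open>e > 0\<close> unfolding \<psi>_def by blast
    show "\<forall>z\<in>ball (us t) d'. \<forall>z'\<in>ball (us t) d'. norm (\<psi> t z - \<psi> t z') \<le> e * norm (z - z')"
      if "\<forall>z\<in>ball (us t) d. \<forall>z'\<in>ball (us t) d. norm (\<psi> t z - \<psi> t z') \<le> e * norm (z - z')"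
        "d' \<le> d" for t d d'
      using that subset_ball[OF that(2), of "us t"] by blast
  qed simp
  obtain \<epsilon>0 where \<epsilon>0: "\<epsilon>0 > 0" "\<And>t. t < T \<Longrightarrow> \<epsilon>0 \<le> \<epsilon> t"
  proof -
    have "\<exists>d>0. \<forall>t\<in>{..<T}. d \<le> \<epsilon> t"
    proof (rule finite_common_radius)
      show "\<exists>d>0. d \<le> \<epsilon> t" if "t \<in> {..<T}" for t
        using \<epsilon>(1)[of t] that by (intro exI[of _ "\<epsilon> t"]) simp
    qed simp_all
    then show thesis using that by blast
  qed
  have "\<exists>d>0. \<forall>t\<in>{..<T}. \<forall>c. norm (\<Sum>j\<in>J. c j *\<^sub>R V j t) < d \<longrightarrow> us t + w t + (\<Sum>j\<in>J. c j *\<^sub>R V j t) \<in> Q t"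
  proof (rule finite_common_radius)
    fix t assume t: "t \<in> {..<T}"
    then have "us t \<in> Q t"
      using tent[of t] cone_contains_0 unfolding tent_def cone_with_vertex_def by force
    then show "\<exists>d>0. \<forall>c. norm (\<Sum>j\<in>J. c j *\<^sub>R V j t) < d \<longrightarrow> us t + w t + (\<Sum>j\<in>J. c j *\<^sub>R V j t) \<in> Q t"
      using t w V \<open>finite J\<close> by (intro rel_interior_contains_combination) (auto simp: hull_inc)
  qed auto
  then obtain \<delta>0 where \<delta>0: "\<delta>0 > 0" "\<And>t c. t < T \<Longrightarrow> norm (\<Sum>j\<in>J. c j *\<^sub>R V j t) < \<delta>0 \<Longrightarrow>
      us t + w t + (\<Sum>j\<in>J. c j *\<^sub>R V j t) \<in> Q t" by blast
  \<comment> \<open>Bounds for the correction directions, the base direction and the constraint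
    matrices; the summand 1 makes them positive, so that they can be divided by.\<close>
  define B where "B = 1 + (\<Sum>t<T. \<Sum>j\<in>J. norm (V j t))"
  define W where "W = 1 + (\<Sum>t<T. norm (w t))"
  define \<Phi> where "\<Phi> = 1 + (\<Sum>j\<in>J. \<Sum>t<T. norm (F t j))"
  have pos: "B > 0" "W > 0" "\<Phi> > 0"
    unfolding B_def W_def \<Phi>_def by (smt (verit) sum_nonneg norm_ge_zero)+
  have Vsum: "norm (\<Sum>j\<in>J. c j *\<^sub>R V j t) \<le> d * B" if "t < T" "\<And>j. \<bar>c j\<bar> \<le> d" for t c d
  proof -
    have "d \<ge> 0" using that(2)[of 0] by linarith
    have "norm (\<Sum>j\<in>J. c j *\<^sub>R V j t) \<le> (\<Sum>j\<in>J. d * norm (V j t))"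
      by (intro sum_norm_le) (auto intro!: mult_right_mono that)
    also have "\<dots> \<le> d * B"
      unfolding B_def sum_distrib_left[symmetric] using \<open>d \<ge> 0\<close> that(1)
        member_le_sum[of t "{..<T}" "\<lambda>t. \<Sum>j\<in>J. norm (V j t)"]
      by (intro mult_left_mono) (auto simp: sum_nonneg)
    finally show ?thesis .
  qed
  have w_le: "norm (w t) \<le> W" if "t < T" for t
    using member_le_sum[of t "{..<T}" "\<lambda>t. norm (w t)"] that unfolding W_def by auto
  have F_le: "\<bar>\<Sum>t<T. F t j \<bullet> x t\<bar> \<le> \<Phi> * d" if "j \<in> J" "\<And>t. t < T \<Longrightarrow> norm (x t) \<le> d" "d \<ge> 0" for j x d
  proof -
    have "\<bar>\<Sum>t<T. F t j \<bullet> x t\<bar> \<le> (\<Sum>t<T. norm (F t j) * d)"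
      unfolding real_norm_def[symmetric]
    proof (rule sum_norm_le)
      fix t assume "t \<in> {..<T}"
      then have "norm (F t j) * norm (x t) \<le> norm (F t j) * d"
        using that(2) by (intro mult_left_mono) auto
      then show "norm (F t j \<bullet> x t) \<le> norm (F t j) * d"
        using Cauchy_Schwarz_ineq2[of "F t j" "x t"] by simp
    qed
    also have "\<dots> \<le> \<Phi> * d"
      unfolding \<Phi>_def sum_distrib_right[symmetric] using that \<open>finite J\<close>
        member_le_sum[of j J "\<lambda>j. \<Sum>t<T. norm (F t j)"]
      by (intro mult_right_mono) (auto simp: sum_nonneg)
    finally show ?thesis .
  qed
  \<comment> \<open>If \<open>\<bar>y j\<bar> \<le> s * \<delta>\<close>, the correction divided by
    \<open>s\<close> has norm at most \<open>\<delta> * B\<close>, which is below the relative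
    interior margin \<open>\<delta>0\<close>.\<close>
  define \<delta> where "\<delta> = \<delta>0 / (2 * B)"
  have \<delta>: "\<delta> > 0" "\<delta> * B < \<delta>0" using pos \<delta>0(1) by (auto simp: \<delta>_def)
  define z where "z s y t = us t + s *\<^sub>R w t + (\<Sum>j\<in>J. y j *\<^sub>R V j t)" for s y t
  define C where "C = W + \<delta> * B"
  have "C > 0" using pos \<delta> by (simp add: C_def add_pos_pos)
  have z_le: "norm (z s y t - us t) \<le> s * C" if "t < T" "s \<ge> 0" "\<And>j. \<bar>y j\<bar> \<le> s * \<delta>" for s y t
  proof -
    have "norm (z s y t - us t) \<le> s * norm (w t) + norm (\<Sum>j\<in>J. y j *\<^sub>R V j t)"
      using norm_triangle_ineq[of "s *\<^sub>R w t"] that(2) by (simp add: z_def)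
    also have "\<dots> \<le> s * W + s * \<delta> * B"
      using w_le Vsum that by (intro add_mono mult_left_mono) auto
    finally show ?thesis by (simp add: C_def algebra_simps)
  qed
  define R where "R s y j = (\<Sum>t<T. F t j \<bullet> \<psi> t (z s y t))" for s y j
  \<comment> \<open>The first entry gives contraction factor 1/2; the second makes the residual at
    \<open>y = 0\<close> at most half of the radius \<open>s * \<delta>\<close>.\<close>
  define e where "e = min (1 / (2 * \<Phi> * B)) (\<delta> / (2 * \<Phi> * W))"
  have e: "e > 0" "\<Phi> * (e * B) \<le> 1 / 2" "\<Phi> * (e * W) \<le> \<delta> / 2"
  proof -
    show "e > 0" using pos \<delta> by (simp add: e_def)
    have "e \<le> 1 / (2 * \<Phi> * B)" "e \<le> \<delta> / (2 * \<Phi> * W)" by (simp_all add: e_def)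
    then show "\<Phi> * (e * B) \<le> 1 / 2" "\<Phi> * (e * W) \<le> \<delta> / 2" using pos by (simp_all add: field_simps)
  qed
  obtain r where r: "r > 0" "\<And>t z z'. t < T \<Longrightarrow> z \<in> ball (us t) r \<Longrightarrow> z' \<in> ball (us t) r \<Longrightarrow>
      norm (\<psi> t z - \<psi> t z') \<le> e * norm (z - z')" using lip'[OF e(1)] by blast
  \<comment> \<open>All arguments \<open>z s y t\<close> lie within \<open>s * C\<close> of
    \<open>us t\<close>; below \<open>s0\<close> this is inside both the Lipschitz radius
    \<open>r\<close> and the tent radius \<open>\<epsilon>0\<close>.\<close>
  define s0 where "s0 = min r \<epsilon>0 / (2 * C)"
  have s0: "s0 > 0" using r(1) \<epsilon>0(1) \<open>C > 0\<close> by (simp add: s0_def)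
  have sC: "s * C < r" "s * C < \<epsilon>0" if "s < s0" for s
  proof -
    have "s * C < s0 * C" using that \<open>C > 0\<close> by simp
    then have "s * C < min r \<epsilon>0 / 2" using \<open>C > 0\<close> by (simp add: s0_def)
    then show "s * C < r" "s * C < \<epsilon>0" using r(1) \<epsilon>0(1) by auto
  qed
  have "\<exists>y. (\<forall>j. \<bar>y j\<bar> \<le> s * \<delta>) \<and> (\<forall>j\<in>J. y j + R s y j = 0)" if s: "0 < s" "s < s0" for s
  proof (rule small_perturbation_of_identity_has_zero)
    have ball: "z s y t \<in> ball (us t) r" if "t < T" "\<And>j. \<bar>y j\<bar> \<le> s * \<delta>" for y t
      using z_le[of t s y, OF that(1) _ that(2)] sC[OF s(2)] s(1) by (simp add: dist_norm norm_minus_commute)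
    fix j assume j: "j \<in> J"
    show "\<bar>R s y j - R s y' j\<bar> \<le> d / 2"
      if y: "\<And>k. \<bar>y k\<bar> \<le> s * \<delta>" "\<And>k. \<bar>y' k\<bar> \<le> s * \<delta>" "\<And>k. \<bar>y k - y' k\<bar> \<le> d" for y y' d
    proof -
      have "d \<ge> 0" using y(3)[of 0] by linarith
      have "norm (\<psi> t (z s y t) - \<psi> t (z s y' t)) \<le> e * (d * B)" if "t < T" for t
      proof -
        have "z s y t - z s y' t = (\<Sum>j\<in>J. (y j - y' j) *\<^sub>R V j t)"
          by (simp add: z_def scaleR_diff_left sum_subtractf)
        then have "norm (z s y t - z s y' t) \<le> d * B" using Vsum[OF that y(3)] by simp
        then have "e * norm (z s y t - z s y' t) \<le> e * (d * B)" using e(1) by (intro mult_left_mono) auto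
        then show ?thesis using r(2)[OF that ball[of t y, OF that y(1)] ball[of t y', OF that y(2)]] by linarith
      qed
      then have "\<bar>\<Sum>t<T. F t j \<bullet> (\<psi> t (z s y t) - \<psi> t (z s y' t))\<bar> \<le> \<Phi> * (e * (d * B))"
        using j \<open>d \<ge> 0\<close> pos e(1) by (intro F_le) auto
      also have "\<dots> = (\<Phi> * (e * B)) * d" by simp
      also have "\<dots> \<le> 1 / 2 * d" using e(2) \<open>d \<ge> 0\<close> by (intro mult_right_mono) auto
      finally show ?thesis by (simp add: R_def inner_diff_right sum_subtractf)
    qed
    show "\<bar>R s (\<lambda>_. 0) j\<bar> \<le> s * \<delta> / 2"
    proof -
      have "norm (\<psi> t (z s (\<lambda>_. 0) t)) \<le> e * (s * W)" if "t < T" for t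
      proof -
        have "norm (\<psi> t (z s (\<lambda>_. 0) t) - \<psi> t (us t)) \<le> e * norm (z s (\<lambda>_. 0) t - us t)"
          using s \<delta>(1) r(1) by (intro r(2) ball that) auto
        also have "\<dots> = e * (s * norm (w t))" using s by (simp add: z_def)
        also have "\<dots> \<le> e * (s * W)" using s e(1) w_le[OF that] by (intro mult_left_mono) auto
        finally show ?thesis by (simp add: \<psi>0[OF that])
      qed
      then have "\<bar>R s (\<lambda>_. 0) j\<bar> \<le> \<Phi> * (e * (s * W))"
        unfolding R_def using j s pos e(1) by (intro F_le) auto
      also have "\<dots> = (\<Phi> * (e * W)) * s" by simp
      also have "\<dots> \<le> \<delta> / 2 * s" using e(3) s by (intro mult_right_mono) auto
      finally show ?thesis by (simp add: mult.commute)
    qed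
  qed (use \<open>finite J\<close> s \<delta> in auto)
  then obtain Y where Y: "\<And>s j. 0 < s \<Longrightarrow> s < s0 \<Longrightarrow> \<bar>Y s j\<bar> \<le> s * \<delta>"
    "\<And>s j. 0 < s \<Longrightarrow> s < s0 \<Longrightarrow> j \<in> J \<Longrightarrow> Y s j + R s (Y s) j = 0" by metis
  \<comment> \<open>The solutions \<open>Y s\<close> are chosen separately for each
    \<open>s\<close>; the one-sided derivative at 0 comes from an \<open>o(s)\<close> bound rather
    than from regularity in \<open>s\<close>. The default \<open>us\<close> fixes the value at
    \<open>s = 0\<close>.\<close>
  define u where "u s = (if 0 < s \<and> s < s0 then (\<lambda>t. \<phi> t (z s (Y s) t)) else us)" for s
  show thesis
  proof (rule that[of u])
    show "u 0 = us" by (simp add: u_def)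
    show "((\<lambda>s. u s t) has_vector_derivative w t) (at 0 within {0..})" if t: "t < T" for t
      unfolding has_vector_derivative_def has_derivative_within_alt
    proof (intro conjI allI impI)
      fix \<eta> :: real assume "\<eta> > 0"
      \<comment> \<open>The deviation has two sources: the error of \<open>\<phi>\<close>, at most
        \<open>e' * (s * C)\<close>, and the correction, at most \<open>\<Phi> * B\<close> times as
        much.\<close>
      define e' where "e' = \<eta> / (C * (\<Phi> * B + 1))"
      have "e' > 0" using \<open>\<eta> > 0\<close> \<open>C > 0\<close> pos by (simp add: e'_def add_pos_pos)
      obtain r' where r': "r' > 0" "\<And>t z z'. t < T \<Longrightarrow> z \<in> ball (us t) r' \<Longrightarrow> z' \<in> ball (us t) r' \<Longrightarrow>
        norm (\<psi> t z - \<psi> t z') \<le> e' * norm (z - z')" using lip'[OF \<open>e' > 0\<close>] by blast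
      have bound: "norm (u s t - u 0 t - s *\<^sub>R w t) \<le> \<eta> * s" if s: "0 < s" "s < s0" "s < r' / C" for s
      proof -
        have \<psi>_le: "norm (\<psi> t (z s (Y s) t)) \<le> e' * (s * C)" if "t < T" for t
        proof -
          have "norm (z s (Y s) t - us t) \<le> s * C" using z_le[OF that] s Y(1) by simp
          moreover have "s * C < r'" using s(3) \<open>C > 0\<close> by (simp add: field_simps)
          ultimately have "norm (\<psi> t (z s (Y s) t) - \<psi> t (us t)) \<le> e' * norm (z s (Y s) t - us t)"
            using r'(1) by (intro r'(2) that) (auto simp: dist_norm norm_minus_commute)
          also have "\<dots> \<le> e' * (s * C)"
            using \<open>norm (z s (Y s) t - us t) \<le> s * C\<close> \<open>e' > 0\<close> by (intro mult_left_mono) auto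
          finally show ?thesis by (simp add: \<psi>0[OF that])
        qed
        \<comment> \<open>\<open>Y s\<close> satisfies the equation only on \<open>J\<close>, while
          \<open>Vsum\<close> wants a bound for every index; setting the other entries to 0 leaves
          the sum unchanged.\<close>
        define y where "y j = (if j \<in> J then Y s j else 0)" for j
        have "\<bar>y j\<bar> \<le> \<Phi> * (e' * (s * C))" for j
        proof (cases "j \<in> J")
          case True
          then have "\<bar>y j\<bar> = \<bar>R s (Y s) j\<bar>" using Y(2)[OF s(1,2)] by (simp add: y_def add_eq_0_iff)
          also have "\<dots> \<le> \<Phi> * (e' * (s * C))"
            unfolding R_def using True \<psi>_le \<open>e' > 0\<close> s \<open>C > 0\<close> by (intro F_le) auto
          finally show ?thesis .
        qed (use pos \<open>e' > 0\<close> s \<open>C > 0\<close> in \<open>simp add: y_def\<close>)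
        from Vsum[of t y, OF t this] have "norm (\<Sum>j\<in>J. Y s j *\<^sub>R V j t) \<le> \<Phi> * (e' * (s * C)) * B"
          by (simp add: y_def)
        moreover have "u s t - u 0 t - s *\<^sub>R w t = \<psi> t (z s (Y s) t) + (\<Sum>j\<in>J. Y s j *\<^sub>R V j t)"
          using s by (simp add: u_def \<psi>_def z_def)
        ultimately have "norm (u s t - u 0 t - s *\<^sub>R w t) \<le> e' * (s * C) + \<Phi> * (e' * (s * C)) * B"
          using \<psi>_le[OF t] norm_triangle_ineq[of "\<psi> t (z s (Y s) t)"] by (smt (verit))
        also have "\<dots> = e' * (C * (\<Phi> * B + 1)) * s" by (simp add: algebra_simps)
        also have "\<dots> = \<eta> * s"
          using \<open>C > 0\<close> pos by (simp add: e'_def add_pos_pos less_imp_neq[symmetric])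
        finally show ?thesis .
      qed
      show "\<exists>d>0. \<forall>y\<in>{0..}. norm (y - 0) < d \<longrightarrow>
          norm (u y t - u 0 t - (y - 0) *\<^sub>R w t) \<le> \<eta> * norm (y - 0)"
      proof (intro exI[of _ "min s0 (r' / C)"] conjI ballI impI)
        fix y :: real assume "y \<in> {0..}" "norm (y - 0) < min s0 (r' / C)"
        then show "norm (u y t - u 0 t - (y - 0) *\<^sub>R w t) \<le> \<eta> * norm (y - 0)"
          using bound[of y] by (cases "y = 0") auto
      qed (use s0 r'(1) \<open>C > 0\<close> in simp)
    qed (rule bounded_linear_scaleR_left)
    have "(\<forall>t<T. u s t \<in> U t) \<and> (\<forall>j\<in>J. (\<Sum>t<T. F t j \<bullet> u s t) = 0)" if s: "0 < s" "s < s0" for s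
    proof (intro conjI allI impI ballI)
      fix t assume t: "t < T"
      \<comment> \<open>The relative interior margin applies to the rescaled coefficients
        \<open>Y s j / s\<close>; dilating the cone about its vertex by \<open>s\<close> then
        returns to \<open>z s (Y s) t\<close>.\<close>
      have "norm (\<Sum>j\<in>J. (Y s j / s) *\<^sub>R V j t) \<le> \<delta> * B"
        using Y(1)[OF s] s by (intro Vsum t) (simp add: field_simps)
      then have in_Q: "us t + w t + (\<Sum>j\<in>J. (Y s j / s) *\<^sub>R V j t) \<in> Q t" using \<delta>0(2) t \<delta>(2) by simp
      obtain K where "cone K" "Q t = (\<lambda>y. us t + y) ` K"
        using tent[OF t] unfolding tent_def cone_with_vertex_def by blast
      then have "us t + s *\<^sub>R x \<in> Q t" if "us t + x \<in> Q t" for x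
        using that s unfolding cone_def by auto
      from this[of "w t + (\<Sum>j\<in>J. (Y s j / s) *\<^sub>R V j t)"] in_Q
      have "z s (Y s) t \<in> Q t"
        using s by (simp add: z_def add.assoc scaleR_add_right scaleR_sum_right)
      moreover have "norm (z s (Y s) t - us t) < \<epsilon> t"
        using z_le[OF t, of s "Y s"] Y(1)[OF s] sC[OF s(2)] s(1) \<epsilon>0(2)[OF t] by simp
      ultimately show "u s t \<in> U t" using \<epsilon>(2) t s by (simp add: u_def)
    next
      fix j assume j: "j \<in> J"
      have "(\<Sum>t<T. F t j \<bullet> (\<Sum>k\<in>J. Y s k *\<^sub>R V k t)) = (\<Sum>k\<in>J. Y s k * (\<Sum>t<T. F t j \<bullet> V k t))"
        by (simp add: inner_sum_right sum_distrib_left) (rule sum.swap)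
      also have "\<dots> = (\<Sum>k\<in>J. if j = k then Y s k else 0)"
        using LV[OF j] by (intro sum.cong) auto
      also have "\<dots> = Y s j" using j \<open>finite J\<close> by simp
      finally have "(\<Sum>t<T. F t j \<bullet> z s (Y s) t) = Y s j"
        using Lus[OF j] Lw[OF j]
        by (simp add: z_def inner_add_right sum.distrib sum_distrib_left[symmetric])
      moreover have "u s t = z s (Y s) t + \<psi> t (z s (Y s) t)" for t using s by (simp add: u_def \<psi>_def)
      ultimately show "(\<Sum>t<T. F t j \<bullet> u s t) = 0"
        using Y(2)[OF s j] by (simp add: R_def inner_add_right sum.distrib)
    qed
    then show "\<forall>\<^sub>F s in at_right 0. (\<forall>t<T. u s t \<in> U t) \<and> (\<forall>j\<in>J. (\<Sum>t<T. F t j \<bullet> u s t) = 0)"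
      unfolding eventually_at_right_field using s0 by blast
  qed
qed

section \<open>Curves and derivatives in charts\<close>

lemma at_within_atLeast_zero: "at (0::real) within {0..} = at_right 0"
proof -
  have "{0..} - {0::real} = {0<..} - {0}" by auto
  then show ?thesis unfolding at_within_def by simp
qed

lemma has_derivative_frechet_partial:
  assumes "(f has_derivative f') (at (x, y))"
  shows "frechet_derivative (\<lambda>z. f (z, y)) (at x) = (\<lambda>v. f' (v, 0))"
    and "(\<lambda>z. f (z, y)) differentiable (at x)"
    and "frechet_derivative (\<lambda>z. f (x, z)) (at y) = (\<lambda>v. f' (0, v))"
    and "(\<lambda>z. f (x, z)) differentiable (at y)"
proof -
  have 1: "((\<lambda>z. f (z, y)) has_derivative (\<lambda>v. f' (v, 0))) (at x)"
    by (rule has_derivative_compose[of "\<lambda>z. (z, y)" "\<lambda>v. (v, 0)" x UNIV f f'])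
      (use assms in \<open>auto intro!: derivative_eq_intros\<close>)
  have 2: "((\<lambda>z. f (x, z)) has_derivative (\<lambda>v. f' (0, v))) (at y)"
    by (rule has_derivative_compose[of "\<lambda>z. (x, z)" "\<lambda>v. (0, v)" y UNIV f f'])
      (use assms in \<open>auto intro!: derivative_eq_intros\<close>)
  show "frechet_derivative (\<lambda>z. f (z, y)) (at x) = (\<lambda>v. f' (v, 0))" "(\<lambda>z. f (z, y)) differentiable (at x)"
    using 1 frechet_derivative_at differentiableI by metis+
  show "frechet_derivative (\<lambda>z. f (x, z)) (at y) = (\<lambda>v. f' (0, v))" "(\<lambda>z. f (x, z)) differentiable (at y)"
    using 2 frechet_derivative_at differentiableI by metis+
qed

lemma is_chart_inj_on: "is_chart M c \<Longrightarrow> inj_on (snd c) (fst c)"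
  unfolding is_chart_def using homeomorphic_imp_injective_map openin_subset topspace_subtopology_subset by metis

lemma is_chart_open_image:
  assumes "is_chart M c" "openin M S" "S \<subseteq> fst c"
  shows "open (snd c ` S)"
proof -
  have "open_map (subtopology M (fst c)) (top_of_set (snd c ` fst c)) (snd c)"
    using assms(1) unfolding is_chart_def by (simp add: homeomorphic_imp_open_map)
  moreover have "openin (subtopology M (fst c)) S"
    using assms by (simp add: openin_subset_topspace_eq is_chart_def openin_open_subtopology)
  ultimately show ?thesis
    using assms(1) unfolding open_map_def is_chart_def by (metis openin_open_trans)
qed

lemma is_chart_prod:
  fixes c :: "('a, 'e::euclidean_space) chart" and c' :: "('b, 'h::euclidean_space) chart"
  assumes "is_chart M c" "is_chart N c'"
  shows "is_chart (prod_topology M N) (fst c \<times> fst c', map_prod (snd c) (snd c'))"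
proof -
  obtain g g' where
    g: "homeomorphic_maps (subtopology M (fst c)) (top_of_set (snd c ` fst c)) (snd c) g" and
    g': "homeomorphic_maps (subtopology N (fst c')) (top_of_set (snd c' ` fst c')) (snd c') g'"
    using assms unfolding is_chart_def homeomorphic_map_maps by blast
  have "homeomorphic_maps (prod_topology (subtopology M (fst c)) (subtopology N (fst c')))
      (prod_topology (top_of_set (snd c ` fst c)) (top_of_set (snd c' ` fst c')))
      (\<lambda>(x, y). (snd c x, snd c' y)) (\<lambda>(x, y). (g x, g' y))"
    using g g' by (subst homeomorphic_maps_prod) blast
  moreover have image: "map_prod (snd c) (snd c') ` (fst c \<times> fst c') = snd c ` fst c \<times> snd c' ` fst c'"
    by (rule map_prod_surj_on) simp_all
  moreover have "(\<lambda>(x, y). (snd c x, snd c' y)) = map_prod (snd c) (snd c')" by (simp add: fun_eq_iff)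
  ultimately have "homeomorphic_map (subtopology (prod_topology M N) (fst c \<times> fst c'))
      (top_of_set (map_prod (snd c) (snd c') ` (fst c \<times> fst c'))) (map_prod (snd c) (snd c'))"
    unfolding homeomorphic_map_maps by (auto simp: subtopology_Times)
  then show ?thesis
    using assms unfolding is_chart_def fst_conv snd_conv image
    by (auto simp: openin_prod_Times_iff open_Times)
qed

lemma is_chart_euc: "c \<in> euc_atlas \<Longrightarrow> is_chart euclidean c"
  by (simp add: euc_atlas_def is_chart_def)

lemma smooth_manifold_chart: "smooth_manifold M A \<Longrightarrow> c \<in> A \<Longrightarrow> is_chart M c"
  by (simp add: smooth_manifold_def)

lemma local_rep_eq: "is_chart M c \<Longrightarrow> x \<in> fst c \<Longrightarrow> local_rep f c c' (snd c x) = snd c' (f x)"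
  by (simp add: local_rep_def inv_into_f_f is_chart_inj_on)

lemma open_local_rep_domain:
  assumes "is_chart M c" "is_chart N c'" "continuous_map M N f"
  shows "open (snd c ` {x \<in> fst c. f x \<in> fst c'})"
proof (rule is_chart_open_image[OF assms(1)])
  have "openin M (fst c \<inter> {x \<in> topspace M. f x \<in> fst c'})"
    using assms by (intro openin_Int openin_continuous_map_preimage) (auto simp: is_chart_def)
  moreover have "fst c \<inter> {x \<in> topspace M. f x \<in> fst c'} = {x \<in> fst c. f x \<in> fst c'}"
    using assms(1) openin_subset unfolding is_chart_def by blast
  ultimately show "openin M {x \<in> fst c. f x \<in> fst c'}" by simp
qed auto

lemma C1_map_has_derivative:
  assumes "C1_map M A N B f" "c \<in> A" "c' \<in> B" "is_chart M c" "is_chart N c'" "x \<in> fst c" "f x \<in> fst c'"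
  shows "(local_rep f c c' has_derivative frechet_derivative (local_rep f c c') (at (snd c x))) (at (snd c x))"
proof -
  have "local_rep f c c' differentiable_on snd c ` {x \<in> fst c. f x \<in> fst c'}"
    using assms(1-3) unfolding C1_map_def One_nat_def by auto
  moreover have "open (snd c ` {x \<in> fst c. f x \<in> fst c'})"
    using assms by (intro open_local_rep_domain) (auto simp: C1_map_def)
  ultimately show ?thesis
    using assms(6,7) by (simp add: differentiable_on_eq_differentiable_at frechet_derivative_works[symmetric])
qed

text \<open>One-sided because the control curves are feasible only for small positive
  \<open>s\<close>. Staying in the chart domain is recorded separately, since the coordinate map has
  no meaning outside it.\<close>

definition has_chart_velocity :: "('a, 'e::euclidean_space) chart \<Rightarrow> (real \<Rightarrow> 'a) \<Rightarrow> 'e \<Rightarrow> bool" where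
  "has_chart_velocity c x \<xi> \<longleftrightarrow> x 0 \<in> fst c \<and> (\<forall>\<^sub>F s in at_right 0. x s \<in> fst c) \<and>
     ((snd c \<circ> x) has_vector_derivative \<xi>) (at 0 within {0..})"

lemma has_chart_velocity_compose:
  assumes x: "has_chart_velocity c x \<xi>" and f: "C1_map M A N B f"
    and c: "c \<in> A" "c' \<in> B" "is_chart M c" "is_chart N c'" and fx: "f (x 0) \<in> fst c'"
  shows "has_chart_velocity c' (f \<circ> x) (frechet_derivative (local_rep f c c') (at (snd c (x 0))) \<xi>)"
proof -
  let ?D = "snd c ` {x \<in> fst c. f x \<in> fst c'}"
  have x0: "x 0 \<in> fst c" and xc: "\<forall>\<^sub>F s in at_right 0. x s \<in> fst c"
    and der: "((snd c \<circ> x) has_vector_derivative \<xi>) (at 0 within {0..})"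
    using x by (auto simp: has_chart_velocity_def)
  have "open ?D" using f c by (intro open_local_rep_domain) (auto simp: C1_map_def)
  moreover have "snd c (x 0) \<in> ?D" using x0 fx by auto
  moreover have "((\<lambda>s. (snd c \<circ> x) s) \<longlongrightarrow> (snd c \<circ> x) 0) (at_right 0)"
    using has_vector_derivative_continuous[OF der] unfolding continuous_within at_within_atLeast_zero .
  ultimately have "\<forall>\<^sub>F s in at_right 0. snd c (x s) \<in> ?D"
    by (auto dest: topological_tendstoD)
  \<comment> \<open>Continuity of the curve is known in coordinates only. Injectivity of the chart
    brings membership in an open coordinate set back to the manifold.\<close>
  with xc have fc': "\<forall>\<^sub>F s in at_right 0. f (x s) \<in> fst c'"
  proof eventually_elim
    case (elim s)
    then obtain y where "y \<in> fst c" "f y \<in> fst c'" "snd c (x s) = snd c y" by auto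
    then show ?case using elim(1) is_chart_inj_on[OF c(3)] by (auto dest: inj_onD)
  qed
  have F: "(local_rep f c c' has_derivative frechet_derivative (local_rep f c c') (at (snd c (x 0)))) (at (snd c (x 0)))"
    by (rule C1_map_has_derivative[OF f c x0 fx])
  have "((\<lambda>s. local_rep f c c' ((snd c \<circ> x) s)) has_derivative
      (\<lambda>h. frechet_derivative (local_rep f c c') (at (snd c (x 0))) (h *\<^sub>R \<xi>))) (at 0 within {0..})"
    using has_derivative_compose[OF der[unfolded has_vector_derivative_def], of "local_rep f c c'"] F by simp
  then have "((\<lambda>s. local_rep f c c' ((snd c \<circ> x) s)) has_vector_derivative
      frechet_derivative (local_rep f c c') (at (snd c (x 0))) \<xi>) (at 0 within {0..})"
    unfolding has_vector_derivative_def
    using linear_scale[OF has_derivative_linear[OF F]] by simp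
  then have "((snd c' \<circ> (f \<circ> x)) has_vector_derivative
      frechet_derivative (local_rep f c c') (at (snd c (x 0))) \<xi>) (at 0 within {0..})"
    unfolding has_vector_derivative_def
  proof (rule has_derivative_transform_eventually)
    show "\<forall>\<^sub>F s in at 0 within {0..}. local_rep f c c' ((snd c \<circ> x) s) = (snd c' \<circ> (f \<circ> x)) s"
      unfolding at_within_atLeast_zero using xc
      by eventually_elim (simp add: local_rep_eq[OF c(3)])
  qed (use x0 in \<open>simp_all add: local_rep_eq[OF c(3)]\<close>)
  then show ?thesis using fc' fx by (simp add: has_chart_velocity_def)
qed

lemma has_chart_velocity_Pair:
  assumes "has_chart_velocity c x \<xi>" "has_chart_velocity c' y \<zeta>"
  shows "has_chart_velocity (fst c \<times> fst c', map_prod (snd c) (snd c')) (\<lambda>s. (x s, y s)) (\<xi>, \<zeta>)"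
proof -
  have "\<forall>\<^sub>F s in at_right 0. (x s, y s) \<in> fst c \<times> fst c'"
    using assms eventually_conj unfolding has_chart_velocity_def by force
  moreover have "((\<lambda>s. (snd c (x s), snd c' (y s))) has_vector_derivative (\<xi>, \<zeta>)) (at 0 within {0..})"
    using assms unfolding has_chart_velocity_def o_def by (intro has_vector_derivative_Pair) auto
  ultimately show ?thesis
    using assms by (simp add: has_chart_velocity_def o_def)
qed

section \<open>Partial derivatives in state and control\<close>

definition control_chart :: "('a, 'e) chart \<Rightarrow> ('a \<times> 'u, 'e \<times> 'u) chart" where
  "control_chart c = (fst c \<times> UNIV, map_prod (snd c) id)"

lemma euc_chart_mem: "(UNIV, id) \<in> euc_atlas"
  by (simp add: euc_atlas_def)

lemma control_chart_mem: "c \<in> A \<Longrightarrow> control_chart c \<in> prod_atlas A euc_atlas"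
  unfolding control_chart_def prod_atlas_def euc_atlas_def by force

lemma is_chart_control_chart:
  fixes c :: "('a, 'e::euclidean_space) chart"
  assumes "is_chart M c"
  shows "is_chart (prod_topology M euclidean) (control_chart c :: ('a \<times> 'u::euclidean_space, _) chart)"
  using is_chart_prod[OF assms is_chart_euc[OF euc_chart_mem]] by (simp add: control_chart_def)

context
  fixes f :: "'a \<times> 'u::euclidean_space \<Rightarrow> 'b" and A :: "('a, 'e::euclidean_space) chart set"
    and B :: "('b, 'h::euclidean_space) chart set" and c c' M N x u
  assumes f: "C1_map (prod_topology M euclidean) (prod_atlas A euc_atlas) N B f"
    and c: "c \<in> A" "c' \<in> B" "is_chart M c" "is_chart N c'" "x \<in> fst c" "f (x, u) \<in> fst c'"
begin

lemma has_derivative_local_rep_control: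
  "(local_rep f (control_chart c) c' has_derivative
    frechet_derivative (local_rep f (control_chart c) c') (at (snd c x, u))) (at (snd c x, u))"
  using C1_map_has_derivative[OF f control_chart_mem[OF c(1)] c(2) is_chart_control_chart[OF c(3)] c(4),
      of "(x, u)"] c(5,6) by (simp add: control_chart_def)

lemma local_rep_control_eq:
  "y \<in> fst c \<Longrightarrow> local_rep f (control_chart c) c' (snd c y, v) = snd c' (f (y, v))"
  using local_rep_eq[OF is_chart_control_chart[OF c(3)], of "(y, v)" f c'] by (simp add: control_chart_def)

text \<open>The joint and the partial local representation agree only on the image of the chart
  domain, as the inverse of the chart is arbitrary elsewhere; hence the transfer along an open set.
  In the control variable the chart is global and the two functions coincide.\<close>

lemma partial_derivative_state:
  shows "frechet_derivative (local_rep (\<lambda>y. f (y, u)) c c') (at (snd c x)) =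
      (\<lambda>v. frechet_derivative (local_rep f (control_chart c) c') (at (snd c x, u)) (v, 0))"
    and "local_rep (\<lambda>y. f (y, u)) c c' differentiable (at (snd c x))"
proof -
  have eq: "local_rep f (control_chart c) c' (z, u) = local_rep (\<lambda>y. f (y, u)) c c' z"
    if "z \<in> snd c ` fst c" for z
    using that by (auto simp: local_rep_control_eq local_rep_eq[OF c(3)])
  have op: "open (snd c ` fst c)" "snd c x \<in> snd c ` fst c" using c(3,5) by (auto simp: is_chart_def)
  note part = has_derivative_frechet_partial[OF has_derivative_local_rep_control]
  show "frechet_derivative (local_rep (\<lambda>y. f (y, u)) c c') (at (snd c x)) =
      (\<lambda>v. frechet_derivative (local_rep f (control_chart c) c') (at (snd c x, u)) (v, 0))"
    using frechet_derivative_transform_within_open[OF part(2) op eq] part(1) by simp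
  obtain D where "((\<lambda>z. local_rep f (control_chart c) c' (z, u)) has_derivative D) (at (snd c x))"
    using part(2) by (auto simp: differentiable_def)
  from has_derivative_transform_within_open[OF this op eq]
  show "local_rep (\<lambda>y. f (y, u)) c c' differentiable (at (snd c x))"
    by (rule differentiableI)
qed

lemma partial_derivative_control:
  shows "frechet_derivative (local_rep (\<lambda>v. f (x, v)) (UNIV, id) c') (at u) =
      (\<lambda>w. frechet_derivative (local_rep f (control_chart c) c') (at (snd c x, u)) (0, w))"
    and "local_rep (\<lambda>v. f (x, v)) (UNIV, id) c' differentiable (at u)"
proof -
  have "(\<lambda>v. local_rep f (control_chart c) c' (snd c x, v)) = local_rep (\<lambda>v. f (x, v)) (UNIV, id) c'"
    using local_rep_control_eq[OF c(5)] by (simp add: fun_eq_iff local_rep_def[of "\<lambda>v. f (x, v)"])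
  then show "frechet_derivative (local_rep (\<lambda>v. f (x, v)) (UNIV, id) c') (at u) =
      (\<lambda>w. frechet_derivative (local_rep f (control_chart c) c') (at (snd c x, u)) (0, w))"
    "local_rep (\<lambda>v. f (x, v)) (UNIV, id) c' differentiable (at u)"
    using has_derivative_frechet_partial(3,4)[OF has_derivative_local_rep_control] by simp_all
qed

end

text \<open>One step of the linearized dynamics; with the real line as target it also differentiates
  a running cost.\<close>

lemma has_chart_velocity_control:
  fixes f :: "'a \<times> 'u::euclidean_space \<Rightarrow> 'b"
  assumes f: "C1_map (prod_topology M euclidean) (prod_atlas A euc_atlas) N B f"
    and c: "c \<in> A" "c' \<in> B" "is_chart M c" "is_chart N c'" "f (x 0, u 0) \<in> fst c'"
    and x: "has_chart_velocity c x \<xi>" and u: "(u has_vector_derivative w) (at 0 within {0..})"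
  shows "has_chart_velocity c' (\<lambda>s. f (x s, u s))
    (frechet_derivative (local_rep (\<lambda>y. f (y, u 0)) c c') (at (snd c (x 0))) \<xi> +
     frechet_derivative (local_rep (\<lambda>v. f (x 0, v)) (UNIV, id) c') (at (u 0)) w)"
proof -
  let ?D = "frechet_derivative (local_rep f (control_chart c) c') (at (snd c (x 0), u 0))"
  have x0: "x 0 \<in> fst c" using x by (simp add: has_chart_velocity_def)
  have "has_chart_velocity (UNIV, id) u w" using u by (simp add: has_chart_velocity_def)
  from has_chart_velocity_Pair[OF x this]
  have "has_chart_velocity (control_chart c) (\<lambda>s. (x s, u s)) (\<xi>, w)" by (simp add: control_chart_def)
  from has_chart_velocity_compose[OF this f control_chart_mem[OF c(1)] c(2) is_chart_control_chart[OF c(3)] c(4)] c(5)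
  have "has_chart_velocity c' (\<lambda>s. f (x s, u s)) (?D (\<xi>, w))" by (simp add: o_def control_chart_def)
  moreover have "?D (\<xi>, w) = ?D (\<xi>, 0) + ?D (0, w)"
    using has_derivative_linear[OF has_derivative_local_rep_control[OF f c(1-4) x0 c(5)]]
    by (simp flip: linear_add)
  ultimately show ?thesis
    by (simp add: partial_derivative_state(1)[OF f c(1-4) x0 c(5)] partial_derivative_control(1)[OF f c(1-4) x0 c(5)])
qed

lemma transition_has_derivative:
  assumes "smooth_manifold M A" "c \<in> A" "c' \<in> A" "x \<in> fst c" "x \<in> fst c'"
  shows "(local_rep id c c' has_derivative frechet_derivative (local_rep id c c') (at (snd c x))) (at (snd c x))"
proof -
  have ch: "is_chart M c" "is_chart M c'" using assms(2,3) smooth_manifold_chart[OF assms(1)] by blast+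
  have "smooth_on (snd c ` (fst c \<inter> fst c')) (local_rep id c c')"
    using assms(1-3) by (simp add: smooth_manifold_def)
  then have "Ck_on (Suc 0) (snd c ` (fst c \<inter> fst c')) (local_rep id c c')"
    unfolding smooth_on_def by (rule spec)
  then have "local_rep id c c' differentiable_on snd c ` (fst c \<inter> fst c')" by simp
  moreover have "open (snd c ` (fst c \<inter> fst c'))"
    using ch by (intro is_chart_open_image[OF ch(1)]) (auto simp: is_chart_def)
  ultimately show ?thesis
    using assms(4,5) by (simp add: differentiable_on_eq_differentiable_at frechet_derivative_works[symmetric])
qed

lemma smooth_manifold_euc: "smooth_manifold euclidean (euc_atlas :: ('e::euclidean_space, 'e) chart set)"
proof -
  have "Ck_on k UNIV (\<lambda>x::'e. v)" for k and v :: 'e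
    by (induction k arbitrary: v) (simp_all add: frechet_derivative_const)
  then have "Ck_on k UNIV (\<lambda>x::'e. x)" for k
    by (cases k) (simp_all add: frechet_derivative_ident differentiable_on_def)
  then have "smooth_on UNIV (id :: 'e \<Rightarrow> 'e)" by (simp add: smooth_on_def id_def)
  moreover have "local_rep id (UNIV, id) (UNIV, id) = (id :: 'e \<Rightarrow> 'e)"
    by (simp add: local_rep_def fun_eq_iff)
  moreover have "second_countable (euclidean :: 'e topology)"
  proof -
    obtain B :: "'e set set" where B: "countable B" "topological_basis B"
      using ex_countable_basis by blast
    show ?thesis
      unfolding second_countable_def
    proof (intro exI[of _ B] conjI ballI allI impI)
      show "openin euclidean C" if "C \<in> B" for C
        using topological_basis_open[OF B(2) that] by simp
      show "\<exists>C\<in>B. x \<in> C \<and> C \<subseteq> U" if U: "openin euclidean U \<and> x \<in> U" for U x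
      proof -
        obtain C where "C \<in> B" "x \<in> C" "C \<subseteq> U"
          using topological_basisE[OF B(2), of U x] U by auto
        then show ?thesis by blast
      qed
    qed (rule B(1))
  qed
  ultimately show ?thesis
    using is_chart_euc[OF euc_chart_mem, where 'a = 'e]
    by (simp add: smooth_manifold_def euc_atlas_def Hausdorff_space_euclidean)
qed

section \<open>Tangent maps and covectors in a chosen chart\<close>

text \<open>The same choice as inside \<open>tangent_map\<close>, so that tangent maps unfold to
  derivatives without a change of source chart.\<close>

definition some_chart :: "('a, 'e) chart set \<Rightarrow> 'a \<Rightarrow> ('a, 'e) chart" where
  "some_chart A x = (SOME c. c \<in> charts_at A x)"

lemma some_chart:
  assumes "smooth_manifold M A" "x \<in> topspace M"
  shows "some_chart A x \<in> charts_at A x" "some_chart A x \<in> A" "x \<in> fst (some_chart A x)"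
    "is_chart M (some_chart A x)"
proof -
  have "(\<Union>c\<in>A. fst c) = topspace M" using assms(1) by (simp add: smooth_manifold_def)
  then have "\<exists>c. c \<in> charts_at A x" using assms(2) unfolding charts_at_def by blast
  then show 1: "some_chart A x \<in> charts_at A x" unfolding some_chart_def by (rule someI_ex)
  then show "some_chart A x \<in> A" "x \<in> fst (some_chart A x)" by (auto simp: charts_at_def)
  then show "is_chart M (some_chart A x)" using smooth_manifold_chart assms(1) by blast
qed

lemma some_chart_euc: "some_chart euc_atlas x = (UNIV, id)"
proof -
  have "charts_at euc_atlas x = {(UNIV, id)}" by (auto simp: charts_at_def euc_atlas_def)
  then show ?thesis by (simp add: some_chart_def)
qed

lemma tangent_map_apply:
  "c' \<in> charts_at B (f x) \<Longrightarrow> tangent_map A B f x v c' =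
     frechet_derivative (local_rep f (some_chart A x) c') (at (snd (some_chart A x) x)) (v (some_chart A x))"
  by (simp add: tangent_map_def some_chart_def Let_def)

text \<open>The chain rule with the transition map of the target. Covectors have prescribed values
  only on the tangent space, so a cotangent lift can be evaluated only once the pushed-forward
  vector is known to belong to it.\<close>

lemma tangent_map_in_tangent_space:
  fixes A :: "('a, 'e::euclidean_space) chart set" and B :: "('b, 'h::euclidean_space) chart set"
  assumes M: "smooth_manifold M A" and N: "smooth_manifold N B"
    and f: "continuous_map M N f" and x: "x \<in> topspace M"
    and diff: "\<And>c'. c' \<in> charts_at B (f x) \<Longrightarrow>
      local_rep f (some_chart A x) c' differentiable (at (snd (some_chart A x) x))"
  shows "tangent_map A B f x v \<in> tangent_space B (f x)"
proof -
  define c where "c = some_chart A x"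
  note ch = some_chart[OF M x, folded c_def]
  have "tangent_map A B f x v c'' =
      frechet_derivative (local_rep id c' c'') (at (snd c' (f x))) (tangent_map A B f x v c')"
    if c': "c' \<in> charts_at B (f x)" and c'': "c'' \<in> charts_at B (f x)" for c' c''
  proof -
    have B: "c' \<in> B" "f x \<in> fst c'" "c'' \<in> B" "f x \<in> fst c''" using c' c'' by (auto simp: charts_at_def)
    have chB: "is_chart N c'" "is_chart N c''" using B(1,3) smooth_manifold_chart[OF N] by blast+
    have lr: "local_rep f c c' (snd c x) = snd c' (f x)" using local_rep_eq[OF ch(4,3)] .
    have d1: "(local_rep f c c' has_derivative frechet_derivative (local_rep f c c') (at (snd c x))) (at (snd c x))"
      using diff[OF c'] unfolding c_def by (simp add: frechet_derivative_works)
    have "((\<lambda>z. local_rep id c' c'' (local_rep f c c' z)) has_derivative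
        (\<lambda>z. frechet_derivative (local_rep id c' c'') (at (snd c' (f x)))
          (frechet_derivative (local_rep f c c') (at (snd c x)) z))) (at (snd c x))"
      by (rule has_derivative_compose[OF d1]) (unfold lr, rule transition_has_derivative[OF N B(1,3,2,4)])
    moreover have "open (snd c ` {y \<in> fst c. f y \<in> fst c'} )" "snd c x \<in> snd c ` {y \<in> fst c. f y \<in> fst c'}"
      using open_local_rep_domain[OF ch(4) chB(1) f] ch(3) B(2) by blast+
    moreover have "local_rep id c' c'' (local_rep f c c' z) = local_rep f c c'' z"
      if "z \<in> snd c ` {y \<in> fst c. f y \<in> fst c'}" for z
      using that by (auto simp: local_rep_eq[OF ch(4)] local_rep_eq[OF chB(1)])
    ultimately have "(local_rep f c c'' has_derivative
        (\<lambda>z. frechet_derivative (local_rep id c' c'') (at (snd c' (f x)))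
          (frechet_derivative (local_rep f c c') (at (snd c x)) z))) (at (snd c x))"
      by (rule has_derivative_transform_within_open)
    from frechet_derivative_at[OF this]
    show ?thesis by (simp add: tangent_map_apply[of c' B f x, OF c'] tangent_map_apply[of c'' B f x, OF c''] flip: c_def) metis
  qed
  then show ?thesis
    unfolding tangent_space_def
  proof (intro CollectI conjI ballI allI impI)
    show "tangent_map A B f x v c' = 0" if "c' \<notin> charts_at B (f x)" for c'
      using that by (simp add: tangent_map_def Let_def)
  qed assumption
qed

definition chart_covector ::
  "('a, 'e::euclidean_space) chart set \<Rightarrow> 'a \<Rightarrow> ('e \<Rightarrow> real) \<Rightarrow> ('a, 'e) tangent \<Rightarrow> real" where
  "chart_covector A x h = (\<lambda>v\<in>tangent_space A x. h (v (some_chart A x)))"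

text \<open>Because of the restriction to the tangent space, linearity requires that space to be
  closed under linear combinations, which is linearity of the transition derivatives.\<close>

lemma chart_covector_in_cotangent_space:
  assumes "smooth_manifold M A" "linear h"
  shows "chart_covector A x h \<in> cotangent_space A x"
proof -
  have "(\<lambda>c. a *\<^sub>R v c + b *\<^sub>R w c) \<in> tangent_space A x"
    if v: "v \<in> tangent_space A x" and w: "w \<in> tangent_space A x" for v w a b
  proof -
    have "linear (frechet_derivative (local_rep id c c') (at (snd c x)))"
      if "c \<in> charts_at A x" "c' \<in> charts_at A x" for c c'
      by (rule has_derivative_linear[OF transition_has_derivative[OF assms(1)]])
        (use that in \<open>simp_all add: charts_at_def\<close>)
    note lin = this
    show ?thesis
      unfolding tangent_space_def
    proof (intro CollectI conjI ballI allI impI)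
      fix c c' assume c: "c \<in> charts_at A x" "c' \<in> charts_at A x"
      let ?D = "frechet_derivative (local_rep id c c') (at (snd c x))"
      have "v c' = ?D (v c)" "w c' = ?D (w c)" using v w c unfolding tangent_space_def by blast+
      moreover have "?D (a *\<^sub>R v c + b *\<^sub>R w c) = a *\<^sub>R ?D (v c) + b *\<^sub>R ?D (w c)"
        by (simp only: linear_add[OF lin[OF c]] linear_scale[OF lin[OF c]])
      ultimately show "a *\<^sub>R v c' + b *\<^sub>R w c' = ?D (a *\<^sub>R v c + b *\<^sub>R w c)" by metis
    next
      fix c assume "c \<notin> charts_at A x"
      then have "v c = 0" "w c = 0" using v w unfolding tangent_space_def by blast+
      then show "a *\<^sub>R v c + b *\<^sub>R w c = 0" by simp
    qed
  qed
  then show ?thesis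
    unfolding cotangent_space_def chart_covector_def
    by (simp add: linear_add[OF assms(2)] linear_scale[OF assms(2)])
qed

lemma cotangent_lift_chart_covector:
  fixes A :: "('a, 'e::euclidean_space) chart set" and B :: "('b, 'h::euclidean_space) chart set"
  assumes "smooth_manifold M A" "smooth_manifold N B" "continuous_map M N f" "x \<in> topspace M"
    and diff: "\<And>c'. c' \<in> charts_at B (f x) \<Longrightarrow>
      local_rep f (some_chart A x) c' differentiable (at (snd (some_chart A x) x))"
    and v: "v \<in> tangent_space A x"
  shows "cotangent_lift A B f x (chart_covector B (f x) h) v =
    h (frechet_derivative (local_rep f (some_chart A x) (some_chart B (f x))) (at (snd (some_chart A x) x))
        (v (some_chart A x)))"
proof -
  have "f x \<in> topspace N" using assms(3,4) continuous_map_image_subset_topspace by blast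
  from some_chart(1)[OF assms(2) this] tangent_map_in_tangent_space[OF assms(1-5)]
  show ?thesis
    using v by (simp add: cotangent_lift_def chart_covector_def tangent_map_apply)
qed

lemma differential_apply:
  "v \<in> tangent_space A x \<Longrightarrow> differential A f x v =
    frechet_derivative (local_rep f (some_chart A x) (UNIV, id)) (at (snd (some_chart A x) x)) (v (some_chart A x))"
  unfolding differential_def by (simp add: tangent_map_apply charts_at_def euc_chart_mem)

lemma euc_tangent_in_tangent_space: "euc_tangent z \<in> tangent_space euc_atlas x"
proof -
  have "local_rep id (UNIV, id) (UNIV, id) = (\<lambda>x :: 'a. x)" by (simp add: local_rep_def fun_eq_iff)
  then show ?thesis
    by (simp add: tangent_space_def euc_tangent_def charts_at_def euc_atlas_def frechet_derivative_ident)
qed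

lemma inner_euc_vector:
  assumes "linear h" "\<And>z. \<eta> (euc_tangent z) = h z"
  shows "euc_vector \<eta> \<bullet> w = h w"
proof -
  have "h w = h (\<Sum>b\<in>Basis. (w \<bullet> b) *\<^sub>R b)" by (simp add: euclidean_representation)
  also have "\<dots> = (\<Sum>b\<in>Basis. (w \<bullet> b) * h b)" by (simp add: linear_sum[OF assms(1)] linear_scale[OF assms(1)])
  finally show ?thesis
    by (simp add: euc_vector_def assms(2) inner_sum_left inner_commute[of w] mult.commute)
qed

section \<open>The discrete adjoint equation\<close>

text \<open>Summation by parts: \<open>p k (\<xi> k)\<close> grows at each step by
  \<open>h k (\<xi> k) + p (Suc k) (z k)\<close>, and the terminal condition supplies the last term
  of the sum of the \<open>h t\<close>.\<close>

lemma discrete_adjoint: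
  fixes a :: "nat \<Rightarrow> 'x::real_vector \<Rightarrow> 'x" and h :: "nat \<Rightarrow> 'x \<Rightarrow> real"
  assumes a: "\<And>t. t < T \<Longrightarrow> linear (a t)" and h: "\<And>t. t \<le> T \<Longrightarrow> linear (h t)"
  obtains p where "\<And>t. t \<le> T \<Longrightarrow> linear (p t)" "\<And>v. p T v = - h T v"
    "\<And>t v. t < T \<Longrightarrow> p t v = p (Suc t) (a t v) - h t v"
    "\<And>\<xi> z. \<xi> 0 = 0 \<Longrightarrow> (\<And>t. t < T \<Longrightarrow> \<xi> (Suc t) = a t (\<xi> t) + z t) \<Longrightarrow>
      (\<Sum>t<T. p (Suc t) (z t)) = - (\<Sum>t\<le>T. h t (\<xi> t))"
proof -
  \<comment> \<open>The recursion runs in the remaining time \<open>k = T - t\<close>, so its step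
    from \<open>k\<close> to \<open>Suc k\<close> uses the data at time
    \<open>T - Suc k\<close>.\<close>
  define r where "r = rec_nat (\<lambda>v. - h T v) (\<lambda>k q v. q (a (T - Suc k) v) - h (T - Suc k) v)"
  define p where "p t = r (T - t)" for t
  have pT: "p T v = - h T v" for v by (simp add: p_def r_def)
  have p_step: "p t v = p (Suc t) (a t v) - h t v" if "t < T" for t v
  proof -
    have "T - t = Suc (T - Suc t)" "T - Suc (T - Suc t) = t" using that by auto
    then show ?thesis by (simp add: p_def r_def)
  qed
  have lin: "linear (p t)" if "t \<le> T" for t
    using that
  proof (induction rule: inc_induct)
    case base
    show ?case using linear_compose_neg[OF h[of T]] pT by (simp add: ext[of "p T" "\<lambda>v. - h T v"])
  next
    case (step t)
    have "linear (\<lambda>v. p (Suc t) (a t v) - h t v)"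
      using linear_compose_sub[OF linear_compose[OF a[of t] step.IH] h[of t]] step.hyps by (simp add: o_def)
    then show ?case using p_step[OF step.hyps(2)] by (simp add: ext[of "p t" "\<lambda>v. p (Suc t) (a t v) - h t v"])
  qed
  have "(\<Sum>t<T. p (Suc t) (z t)) = - (\<Sum>t\<le>T. h t (\<xi> t))"
    if \<xi>: "\<xi> 0 = 0" "\<And>t. t < T \<Longrightarrow> \<xi> (Suc t) = a t (\<xi> t) + z t" for \<xi> z
  proof -
    have "(\<Sum>t<k. p (Suc t) (z t)) = p k (\<xi> k) - (\<Sum>t<k. h t (\<xi> t))" if "k \<le> T" for k
      using that
    proof (induction k)
      case 0
      then show ?case using linear_0[OF lin[of 0]] \<xi>(1) by simp
    next
      case (Suc k)
      then show ?case
        using p_step[of k "\<xi> k"] \<xi>(2)[of k] linear_add[OF lin[of "Suc k"]] by simp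
    qed
    from this[of T] show ?thesis
      using pT[of "\<xi> T"] unfolding lessThan_Suc_atMost[symmetric] sum.lessThan_Suc by linarith
  qed
  with lin pT p_step show thesis by (rule that[of p])
qed

section \<open>The control problem along an optimal trajectory\<close>

locale optimal_trajectory =
  fixes M :: "'a topology" and A :: "('a, real^'d) chart set"
    and T l :: nat and n :: "nat \<Rightarrow> nat" and xbar :: 'a
    and f :: "nat \<Rightarrow> 'a \<times> (real^'m) \<Rightarrow> 'a"
    and c :: "nat \<Rightarrow> 'a \<times> (real^'m) \<Rightarrow> real" and cT :: "'a \<Rightarrow> real"
    and g :: "nat \<Rightarrow> 'a \<Rightarrow> nat \<Rightarrow> real"
    and U q :: "nat \<Rightarrow> (real^'m) set" and F :: "nat \<Rightarrow> nat \<Rightarrow> real^'m"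
    and xs :: "nat \<Rightarrow> 'a" and us :: "nat \<Rightarrow> real^'m"
  assumes M: "smooth_manifold M A" and xbar: "xbar \<in> topspace M"
    and f: "\<And>t. t < T \<Longrightarrow> C1_map (prod_topology M euclidean) (prod_atlas A euc_atlas) M A (f t)"
    and c: "\<And>t. t < T \<Longrightarrow>
           C1_map (prod_topology M euclidean) (prod_atlas A euc_atlas) euclidean euc_atlas (c t)"
    and cT: "C1_map M A euclidean euc_atlas cT"
    and g: "\<And>t j. t \<in> {1..T} \<Longrightarrow> j \<in> {1..n t} \<Longrightarrow> C1_map M A euclidean euc_atlas (\<lambda>x. g t x j)"
    and optimal: "optimal M T xbar f c cT n g U l F xs us"
    and q: "\<And>t. t < T \<Longrightarrow> local_tent (U t) (us t) (q t)"
begin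

definition "ch t = some_chart A (xs t)"

definition "fx t = frechet_derivative (local_rep (\<lambda>x. f t (x, us t)) (ch t) (ch (Suc t))) (at (snd (ch t) (xs t)))"

definition "fu t = frechet_derivative (local_rep (\<lambda>u. f t (xs t, u)) (UNIV, id) (ch (Suc t))) (at (us t))"

text \<open>At the final time, \<open>cx T\<close> is the differential of the final cost.\<close>

definition "cx t = (if t < T
  then frechet_derivative (local_rep (\<lambda>x. c t (x, us t)) (ch t) (UNIV, id)) (at (snd (ch t) (xs t)))
  else frechet_derivative (local_rep cT (ch t) (UNIV, id)) (at (snd (ch t) (xs t))))"

definition "cu t = frechet_derivative (local_rep (\<lambda>u. c t (xs t, u)) (UNIV, id) (UNIV, id)) (at (us t))"

definition "gx t j = frechet_derivative (local_rep (\<lambda>x. g t x j) (ch t) (UNIV, id)) (at (snd (ch t) (xs t)))"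

definition response :: "(nat \<Rightarrow> real^'m) \<Rightarrow> nat \<Rightarrow> real^'d" where
  "response w = rec_nat 0 (\<lambda>t v. fx t v + fu t (w t))"

definition trajectory :: "(nat \<Rightarrow> real^'m) \<Rightarrow> nat \<Rightarrow> 'a" where
  "trajectory u = rec_nat xbar (\<lambda>t x. f t (x, u t))"

lemma response_simps [simp]: "response w 0 = 0" "response w (Suc t) = fx t (response w t) + fu t (w t)"
  by (simp_all add: response_def)

lemma trajectory_simps [simp]: "trajectory u 0 = xbar" "trajectory u (Suc t) = f t (trajectory u t, u t)"
  by (simp_all add: trajectory_def)

lemma admissible: "admissible M T xbar f n g U l F xs us"
  using optimal by (simp add: optimal_def)

lemma xs_topspace: "t \<le> T \<Longrightarrow> xs t \<in> topspace M"
  and xs_Suc: "t < T \<Longrightarrow> xs (Suc t) = f t (xs t, us t)"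
  and xs_0: "xs 0 = xbar"
  and us_constraint: "i \<in> {1..l} \<Longrightarrow> (\<Sum>t<T. F t i \<bullet> us t) = 0"
  using admissible by (simp_all add: admissible_def linear_constraint_def)

lemma chart:
  assumes "t \<le> T"
  shows "ch t \<in> A" "xs t \<in> fst (ch t)" "is_chart M (ch t)"
  unfolding ch_def using some_chart(2-4)[OF M xs_topspace[OF assms]] .

lemma trajectory_us: "t \<le> T \<Longrightarrow> trajectory us t = xs t"
  by (induction t) (auto simp: xs_0 xs_Suc)

lemma trajectory_topspace: "t \<le> T \<Longrightarrow> trajectory u t \<in> topspace M"
proof (induction t)
  case (Suc t)
  then have "continuous_map (prod_topology M euclidean) M (f t)" using f by (simp add: C1_map_def)
  then show ?case using Suc continuous_map_image_subset_topspace by fastforce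
qed (simp add: xbar)

text \<open>Stated for every chart around the successor state, since membership of a pushed-forward
  vector in the tangent space tests all of them.\<close>

lemma partial_f:
  assumes "t < T" "c' \<in> charts_at A (xs (Suc t))"
  shows "local_rep (\<lambda>y. f t (y, us t)) (ch t) c' differentiable (at (snd (ch t) (xs t)))"
    and "local_rep (\<lambda>v. f t (xs t, v)) (UNIV, id) c' differentiable (at (us t))"
proof -
  have c': "c' \<in> A" "is_chart M c'" "f t (xs t, us t) \<in> fst c'"
    using assms smooth_manifold_chart[OF M] by (simp_all add: charts_at_def xs_Suc)
  have "t \<le> T" using assms(1) by simp
  note ch = chart[OF this]
  show "local_rep (\<lambda>y. f t (y, us t)) (ch t) c' differentiable (at (snd (ch t) (xs t)))"
    by (rule partial_derivative_state(2)[OF f[OF assms(1)] ch(1) c'(1) ch(3) c'(2) ch(2) c'(3)])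
  show "local_rep (\<lambda>v. f t (xs t, v)) (UNIV, id) c' differentiable (at (us t))"
    by (rule partial_derivative_control(2)[OF f[OF assms(1)] ch(1) c'(1) ch(3) c'(2) ch(2) c'(3)])
qed

lemma linear_frechet_derivative: "h differentiable (at x) \<Longrightarrow> linear (frechet_derivative h (at x))"
  using frechet_derivative_works has_derivative_linear by blast

lemma linear_fx: "t < T \<Longrightarrow> linear (fx t)" and linear_fu: "t < T \<Longrightarrow> linear (fu t)"
  unfolding fx_def fu_def using partial_f[of t "ch (Suc t)"] some_chart(1)[OF M xs_topspace[of "Suc t"]]
  by (simp_all add: linear_frechet_derivative ch_def[of "Suc t"])

lemma linear_C1_map:
  assumes "C1_map M A euclidean euc_atlas h" "t \<le> T"
  shows "linear (frechet_derivative (local_rep h (ch t) (UNIV, id)) (at (snd (ch t) (xs t))))"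
  using C1_map_has_derivative[OF assms(1) chart(1)[OF assms(2)] euc_chart_mem chart(3)[OF assms(2)]
      is_chart_euc[OF euc_chart_mem] chart(2)[OF assms(2)]] has_derivative_linear by simp

lemma linear_gx: "t \<in> {1..T} \<Longrightarrow> j \<in> {1..n t} \<Longrightarrow> linear (gx t j)"
  unfolding gx_def by (intro linear_C1_map g) auto

lemma partial_c:
  assumes "t < T"
  shows "local_rep (\<lambda>y. c t (y, us t)) (ch t) (UNIV, id) differentiable (at (snd (ch t) (xs t)))"
    and "local_rep (\<lambda>v. c t (xs t, v)) (UNIV, id) (UNIV, id) differentiable (at (us t))"
proof -
  have "t \<le> T" using assms(1) by simp
  note ch = chart[OF this]
  have u: "c t (xs t, us t) \<in> fst (UNIV, id :: real \<Rightarrow> real)" by simp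
  show "local_rep (\<lambda>y. c t (y, us t)) (ch t) (UNIV, id) differentiable (at (snd (ch t) (xs t)))"
    by (rule partial_derivative_state(2)[OF c[OF assms(1)] ch(1) euc_chart_mem ch(3) is_chart_euc[OF euc_chart_mem] ch(2) u])
  show "local_rep (\<lambda>v. c t (xs t, v)) (UNIV, id) (UNIV, id) differentiable (at (us t))"
    by (rule partial_derivative_control(2)[OF c[OF assms(1)] ch(1) euc_chart_mem ch(3) is_chart_euc[OF euc_chart_mem] ch(2) u])
qed

lemma linear_cx: "t \<le> T \<Longrightarrow> linear (cx t)" and linear_cu: "t < T \<Longrightarrow> linear (cu t)"
  unfolding cx_def cu_def using partial_c linear_C1_map[OF cT] by (simp_all add: linear_frechet_derivative)

lemma response_linear:
  assumes "t \<le> T"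
  shows "response (\<lambda>t. a *\<^sub>R v t + b *\<^sub>R w t) t = a *\<^sub>R response v t + b *\<^sub>R response w t"
  using assms
proof (induction t)
  case (Suc t)
  then have t: "t < T" by simp
  show ?case
    using Suc t by (simp add: linear_add[OF linear_fx[OF t]] linear_scale[OF linear_fx[OF t]]
        linear_add[OF linear_fu[OF t]] linear_scale[OF linear_fu[OF t]] scaleR_add_right)
qed simp

definition "active = {(t, j). t \<in> {1..T} \<and> j \<in> {1..n t} \<and> g t (xs t) j = 0}"

definition "dcost w = (\<Sum>t<T. cu t (w t)) + (\<Sum>t\<le>T. cx t (response w t))"

lemma finite_active: "finite active"
proof (rule finite_subset)
  show "active \<subseteq> (SIGMA t:{1..T}. {1..n t})" by (auto simp: active_def)
qed auto

section \<open>First variation along a curve of controls\<close>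

context
  fixes u :: "real \<Rightarrow> nat \<Rightarrow> real^'m" and w :: "nat \<Rightarrow> real^'m"
  assumes u0: "u 0 = us"
    and u: "\<And>t. t < T \<Longrightarrow> ((\<lambda>s. u s t) has_vector_derivative w t) (at 0 within {0..})"
begin

lemma trajectory_velocity: "t \<le> T \<Longrightarrow> has_chart_velocity (ch t) (\<lambda>s. trajectory (u s) t) (response w t)"
proof (induction t)
  case 0
  then show ?case using chart[of 0] by (simp add: has_chart_velocity_def xs_0 o_def)
next
  case (Suc t)
  then have t: "t < T" "t \<le> T" by simp_all
  have "f t (trajectory (u 0) t, u 0 t) \<in> fst (ch (Suc t))"
    using chart(2)[OF Suc.prems] t by (simp add: u0 trajectory_us xs_Suc)
  from has_chart_velocity_control[OF f[OF t(1)] chart(1)[OF t(2)] chart(1)[OF Suc.prems]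
      chart(3)[OF t(2)] chart(3)[OF Suc.prems], of "\<lambda>s. trajectory (u s) t" "\<lambda>s. u s t", OF this
      Suc.IH[OF t(2)] u[OF t(1)]]
  show ?case by (simp add: u0 trajectory_us t fx_def fu_def)
qed

lemma euc_velocity:
  "has_chart_velocity (UNIV, id) y D \<Longrightarrow> (y has_vector_derivative D) (at 0 within {0..})"
  by (simp add: has_chart_velocity_def)

lemma state_function_derivative:
  assumes h: "C1_map M A euclidean euc_atlas h" and "t \<le> T"
  shows "((\<lambda>s. h (trajectory (u s) t)) has_vector_derivative
    frechet_derivative (local_rep h (ch t) (UNIV, id)) (at (snd (ch t) (xs t))) (response w t)) (at 0 within {0..})"
  using has_chart_velocity_compose[OF trajectory_velocity[OF assms(2)] h chart(1)[OF assms(2)] euc_chart_mem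
      chart(3)[OF assms(2)] is_chart_euc[OF euc_chart_mem]] assms(2)
  by (intro euc_velocity) (simp add: u0 trajectory_us o_def)

lemma cost_derivative:
  "((\<lambda>s. total_cost T c cT (trajectory (u s)) (u s)) has_vector_derivative dcost w) (at 0 within {0..})"
proof -
  have "((\<lambda>s. c t (trajectory (u s) t, u s t)) has_vector_derivative (cx t (response w t) + cu t (w t))) (at 0 within {0..})"
    if t: "t < T" for t
  proof -
    have t': "t \<le> T" using t by simp
    have "c t (trajectory (u 0) t, u 0 t) \<in> fst (UNIV, id :: real \<Rightarrow> real)" by simp
    from has_chart_velocity_control[OF c[OF t] chart(1)[OF t'] euc_chart_mem chart(3)[OF t']
        is_chart_euc[OF euc_chart_mem], of "\<lambda>s. trajectory (u s) t" "\<lambda>s. u s t", OF this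
        trajectory_velocity[OF t'] u[OF t]]
    show ?thesis
      using t by (intro euc_velocity) (simp add: u0 trajectory_us cx_def cu_def)
  qed
  then have "((\<lambda>s. (\<Sum>t<T. c t (trajectory (u s) t, u s t)) + cT (trajectory (u s) T)) has_vector_derivative
      ((\<Sum>t<T. cx t (response w t) + cu t (w t)) + cx T (response w T))) (at 0 within {0..})"
    using state_function_derivative[OF cT, of T]
    by (intro has_vector_derivative_add has_vector_derivative_sum) (auto simp: cx_def)
  moreover have "(\<Sum>t<T. cx t (response w t) + cu t (w t)) + cx T (response w T) = dcost w"
    by (simp add: dcost_def sum.distrib lessThan_Suc_atMost[symmetric])
  ultimately show ?thesis by (simp add: total_cost_def)
qed

text \<open>For small positive \<open>s\<close>, active constraints become negative by their
  derivative and inactive ones stay negative by continuity. As there are finitely many, one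
  \<open>s\<close> serves for all of them together with the cost, and the curve beats the optimum
  there.\<close>

lemma no_feasible_descent:
  assumes feasible: "\<forall>\<^sub>F s in at_right 0. (\<forall>t<T. u s t \<in> U t) \<and> (\<forall>j\<in>{1..l}. (\<Sum>t<T. F t j \<bullet> u s t) = 0)"
    and descent: "dcost w < 0" "\<And>t j. (t, j) \<in> active \<Longrightarrow> gx t j (response w t) < 0"
  shows False
proof -
  have decrease: "\<forall>\<^sub>F s in at_right 0. h s < h 0"
    if "(h has_vector_derivative D) (at 0 within {0..})" "D < 0" for h :: "real \<Rightarrow> real" and D
  proof -
    have "(h has_real_derivative D) (at 0 within {0..})"
      using that(1) by (simp add: has_real_derivative_iff_has_vector_derivative)
    from has_real_derivative_neg_dec_right[OF this that(2)]
    obtain d where "d > 0" "\<forall>s>0. s < d \<longrightarrow> h s < h 0" by auto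
    then show ?thesis unfolding eventually_at_right_field by blast
  qed
  have "\<forall>\<^sub>F s in at_right 0. g t (trajectory (u s) t) j \<le> 0" if tj: "t \<in> {1..T}" "j \<in> {1..n t}" for t j
  proof -
    have t: "t \<le> T" using tj by simp
    note der = state_function_derivative[OF g[OF tj] t, folded gx_def]
    have g0: "g t (trajectory (u 0) t) j = g t (xs t) j" using t by (simp add: u0 trajectory_us)
    show ?thesis
    proof (cases "(t, j) \<in> active")
      case True
      then have "\<forall>\<^sub>F s in at_right 0. g t (trajectory (u s) t) j < g t (trajectory (u 0) t) j"
        using decrease[OF der] descent(2) by blast
      then show ?thesis
        using True g0 by (auto simp: active_def elim: eventually_mono)
    next
      case False
      then have "g t (trajectory (u 0) t) j < 0"
        using tj g0 admissible unfolding active_def admissible_def by force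
      moreover have "((\<lambda>s. g t (trajectory (u s) t) j) \<longlongrightarrow> g t (trajectory (u 0) t) j) (at_right 0)"
        using has_vector_derivative_continuous[OF der] unfolding continuous_within at_within_atLeast_zero .
      ultimately have "\<forall>\<^sub>F s in at_right 0. g t (trajectory (u s) t) j < 0" by (auto dest: order_tendstoD(2))
      then show ?thesis by (auto elim: eventually_mono)
    qed
  qed
  then have "\<forall>\<^sub>F s in at_right 0. \<forall>t\<in>{1..T}. \<forall>j\<in>{1..n t}. g t (trajectory (u s) t) j \<le> 0"
    by (simp add: eventually_ball_finite_distrib)
  moreover have "\<forall>\<^sub>F s in at_right 0. total_cost T c cT (trajectory (u s)) (u s)
      < total_cost T c cT (trajectory (u 0)) (u 0)"
    using decrease[OF cost_derivative descent(1)] .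
  ultimately have "\<forall>\<^sub>F s in at_right (0::real). False"
    using feasible
  proof eventually_elim
    case (elim s)
    then have "admissible M T xbar f n g U l F (trajectory (u s)) (u s)"
      using trajectory_topspace by (simp add: admissible_def linear_constraint_def)
    then have "total_cost T c cT xs us \<le> total_cost T c cT (trajectory (u s)) (u s)"
      using optimal by (simp add: optimal_def)
    moreover have "total_cost T c cT (trajectory (u 0)) (u 0) = total_cost T c cT xs us"
      by (simp add: total_cost_def u0 trajectory_us)
    ultimately show False using elim by simp
  qed
  then show False by (simp add: eventually_False)
qed

end

end

section \<open>From separation to adjoint multipliers\<close>

context optimal_trajectory
begin

definition "control_cone t = {w. us t + w \<in> q t}"

lemma control_cone:
  assumes "t < T"
  shows "convex (control_cone t)" "cone (control_cone t)" "control_cone t \<noteq> {}"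
    "q t = (\<lambda>w. us t + w) ` control_cone t"
proof -
  have lt: "local_tent (U t) (us t) (q t)" by (rule q[OF assms])
  then obtain K where K: "K \<noteq> {}" "cone K" "q t = (\<lambda>y. us t + y) ` K"
    by (auto simp: local_tent_def cone_with_vertex_def)
  have eq: "control_cone t = K" by (auto simp: control_cone_def K(3))
  have "convex ((\<lambda>y. us t + y) ` K)" using lt K(3) by (simp add: local_tent_def)
  then show "convex (control_cone t)" "cone (control_cone t)" "control_cone t \<noteq> {}"
    "q t = (\<lambda>w. us t + w) ` control_cone t"
    using K by (simp_all add: eq convex_translation_eq)
qed

text \<open>This is where local tents enter: the tent \<open>Q t\<close> depends on \<open>w\<close>
  and may be smaller than \<open>q t\<close>, so it need not contain the correction directions. They
  still lie in its affine hull, which equals that of \<open>q t\<close>, and this is all the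
  correction asks for.\<close>

lemma no_descent_direction:
  assumes w: "\<And>t. t < T \<Longrightarrow> w t \<in> rel_interior (control_cone t)"
    and descent: "dcost w < 0" "\<And>t j. (t, j) \<in> active \<Longrightarrow> gx t j (response w t) < 0"
    and Lw: "\<And>j. j \<in> {1..l} \<Longrightarrow> (\<Sum>t<T. F t j \<bullet> w t) = 0"
    and V: "\<And>t j. t < T \<Longrightarrow> V j t \<in> control_cone t"
    and LV: "\<And>j k. j \<in> {1..l} \<Longrightarrow> (\<Sum>t<T. F t j \<bullet> V k t) = (if j = k then 1 else 0)"
  shows False
proof -
  have "\<forall>t. \<exists>Q. t < T \<longrightarrow> tent (U t) (us t) Q \<and> us t + w t \<in> rel_interior Q \<and>
      affine hull Q = affine hull q t"
  proof
    fix t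
    show "\<exists>Q. t < T \<longrightarrow> tent (U t) (us t) Q \<and> us t + w t \<in> rel_interior Q \<and> affine hull Q = affine hull q t"
    proof (cases "t < T")
      case True
      have "us t + w t \<in> rel_interior (q t)"
        unfolding control_cone(4)[OF True] rel_interior_translation using w[OF True] by simp
      then show ?thesis using q[OF True] unfolding local_tent_def by blast
    qed simp
  qed
  then obtain Q where Q: "\<forall>t. t < T \<longrightarrow> tent (U t) (us t) (Q t) \<and> us t + w t \<in> rel_interior (Q t) \<and>
      affine hull Q t = affine hull q t"
    unfolding choice_iff by blast
  have VQ: "us t + V j t \<in> affine hull (Q t)" if "t < T" for t j
    using Q V[OF that, of j] that by (simp add: control_cone_def hull_inc)
  show False
  proof (rule feasible_control_curve[of T U us Q w "{1..l}" V F])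
    show "tent (U t) (us t) (Q t)" "us t + w t \<in> rel_interior (Q t)" if "t < T" for t using Q that by simp_all
    fix u :: "real \<Rightarrow> nat \<Rightarrow> real^'m"
    assume u: "u 0 = us" "\<And>t. t < T \<Longrightarrow> ((\<lambda>s. u s t) has_vector_derivative w t) (at 0 within {0..})"
      "\<forall>\<^sub>F s in at_right 0. (\<forall>t<T. u s t \<in> U t) \<and> (\<forall>j\<in>{1..l}. (\<Sum>t<T. F t j \<bullet> u s t) = 0)"
    show False by (rule no_feasible_descent[OF u descent])
  qed (use VQ us_constraint Lw LV in auto)
qed

lemma multipliers_exist:
  obtains \<eta>c \<eta>x \<eta>u where "\<eta>c \<ge> 0" "\<And>t j. \<eta>x t j \<ge> 0" "\<And>t j. (t, j) \<notin> active \<Longrightarrow> \<eta>x t j = 0"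
    "\<And>i. i \<notin> {1..l} \<Longrightarrow> \<eta>u i = 0"
    "\<eta>c \<noteq> 0 \<or> (\<exists>(t, j)\<in>active. \<eta>x t j \<noteq> 0) \<or> (\<exists>i\<in>{1..l}. \<eta>u i \<noteq> 0)"
    "\<And>w. (\<And>t. t < T \<Longrightarrow> us t + w t \<in> q t) \<Longrightarrow>
      (\<Sum>i=1..l. \<eta>u i * (\<Sum>t<T. F t i \<bullet> w t)) \<le>
      \<eta>c * dcost w + (\<Sum>(t, j)\<in>active. \<eta>x t j * gx t j (response w t))"
proof -
  \<comment> \<open>The index \<open>None\<close> stands for the cost and \<open>Some (t, j)\<close>
    for an active state constraint.\<close>
  define p where "p k w = (case k of None \<Rightarrow> dcost w | Some (t, j) \<Rightarrow> gx t j (response w t))" for k w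
  define I where "I = insert None (Some ` active)"
  have sumI: "(\<Sum>k\<in>I. h k) = h None + (\<Sum>(t, j)\<in>active. h (Some (t, j)))" for h :: "_ \<Rightarrow> real"
    unfolding I_def using finite_active by (simp add: sum.reindex o_def case_prod_unfold)
  have act: "t \<in> {1..T} \<and> j \<in> {1..n t}" if "(t, j) \<in> active" for t j using that by (simp add: active_def)
  show thesis
  proof (rule multipliers_or_descent_direction[of I "{1..l}" T control_cone p "\<lambda>j w. \<Sum>t<T. F t j \<bullet> w t"])
    show "finite I" using finite_active by (simp add: I_def)
    show "convex (control_cone t) \<and> cone (control_cone t) \<and> control_cone t \<noteq> {}" if "t < T" for t
      using control_cone[OF that] by simp
    show "p k (\<lambda>t. a *\<^sub>R v t + b *\<^sub>R w t) = a * p k v + b * p k w" if k: "k \<in> I" for k a b v w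
    proof (cases k)
      case None
      have "(\<Sum>t<T. cu t (a *\<^sub>R v t + b *\<^sub>R w t)) = a * (\<Sum>t<T. cu t (v t)) + b * (\<Sum>t<T. cu t (w t))"
        unfolding sum_distrib_left sum.distrib[symmetric]
        by (intro sum.cong) (simp_all add: linear_add[OF linear_cu] linear_scale[OF linear_cu])
      moreover have "(\<Sum>t\<le>T. cx t (response (\<lambda>t. a *\<^sub>R v t + b *\<^sub>R w t) t))
          = a * (\<Sum>t\<le>T. cx t (response v t)) + b * (\<Sum>t\<le>T. cx t (response w t))"
        unfolding sum_distrib_left sum.distrib[symmetric]
        by (intro sum.cong)
          (simp_all add: response_linear linear_add[OF linear_cx] linear_scale[OF linear_cx])
      ultimately show ?thesis using None by (simp add: p_def dcost_def algebra_simps)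
    next
      case (Some tj)
      then obtain t j where tj: "tj = (t, j)" "(t, j) \<in> active" using k by (cases tj) (auto simp: I_def)
      have lin: "linear (gx t j)" using act[OF tj(2)] linear_gx by blast
      have "t \<le> T" using act[OF tj(2)] by simp
      then show ?thesis
        by (simp add: p_def Some tj response_linear linear_add[OF lin] linear_scale[OF lin])
    qed
    show "(\<Sum>t<T. F t j \<bullet> (a *\<^sub>R v t + b *\<^sub>R w t)) = a * (\<Sum>t<T. F t j \<bullet> v t) + b * (\<Sum>t<T. F t j \<bullet> w t)"
      for j a b v w
      by (simp add: inner_add_right sum.distrib sum_distrib_left)
  next
    fix \<nu> \<mu>
    assume \<nu>: "\<And>k. k \<in> I \<Longrightarrow> \<nu> k \<ge> 0" and nontriv: "(\<exists>k\<in>I. \<nu> k \<noteq> 0) \<or> (\<exists>j\<in>{1..l}. \<mu> j \<noteq> 0)"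
      and le: "\<And>w. (\<And>t. t < T \<Longrightarrow> w t \<in> control_cone t) \<Longrightarrow>
        (\<Sum>j=1..l. \<mu> j * (\<Sum>t<T. F t j \<bullet> w t)) \<le> (\<Sum>k\<in>I. \<nu> k * p k w)"
    define \<eta>x where "\<eta>x t j = (if (t, j) \<in> active then \<nu> (Some (t, j)) else 0)" for t j
    define \<eta>u where "\<eta>u i = (if i \<in> {1..l} then \<mu> i else 0)" for i
    show thesis
    proof (rule that[of "\<nu> None" \<eta>x \<eta>u])
      show "\<nu> None \<ge> 0" using \<nu> by (simp add: I_def)
      show "\<eta>x t j \<ge> 0" for t j using \<nu> by (simp add: I_def \<eta>x_def)
      show "\<nu> None \<noteq> 0 \<or> (\<exists>(t, j)\<in>active. \<eta>x t j \<noteq> 0) \<or> (\<exists>i\<in>{1..l}. \<eta>u i \<noteq> 0)"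
        using nontriv by (auto simp: I_def \<eta>x_def \<eta>u_def split: prod.splits)
      fix w assume "\<And>t. t < T \<Longrightarrow> us t + w t \<in> q t"
      then have "(\<Sum>j=1..l. \<mu> j * (\<Sum>t<T. F t j \<bullet> w t)) \<le> (\<Sum>k\<in>I. \<nu> k * p k w)"
        by (intro le) (simp add: control_cone_def)
      also have "\<dots> = \<nu> None * dcost w + (\<Sum>(t, j)\<in>active. \<eta>x t j * gx t j (response w t))"
        unfolding sumI by (auto simp: p_def \<eta>x_def intro!: sum.cong)
      also have "(\<Sum>j=1..l. \<mu> j * (\<Sum>t<T. F t j \<bullet> w t)) = (\<Sum>i=1..l. \<eta>u i * (\<Sum>t<T. F t i \<bullet> w t))"
        by (intro sum.cong) (simp_all add: \<eta>u_def)
      finally show "(\<Sum>i=1..l. \<eta>u i * (\<Sum>t<T. F t i \<bullet> w t)) \<le>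
          \<nu> None * dcost w + (\<Sum>(t, j)\<in>active. \<eta>x t j * gx t j (response w t))" .
    qed (auto simp: \<eta>x_def \<eta>u_def)
  next
    fix w V
    assume w: "\<And>t. t < T \<Longrightarrow> w t \<in> rel_interior (control_cone t)" "\<And>k. k \<in> I \<Longrightarrow> p k w < 0"
      "\<And>j. j \<in> {1..l} \<Longrightarrow> (\<Sum>t<T. F t j \<bullet> w t) = 0"
      and V: "\<And>t j. t < T \<Longrightarrow> V j t \<in> control_cone t"
      "\<And>j k. j \<in> {1..l} \<Longrightarrow> (\<Sum>t<T. F t j \<bullet> V k t) = (if j = k then 1 else 0)"
    have "dcost w < 0" using w(2)[of None] by (simp add: I_def p_def)
    moreover have "gx t j (response w t) < 0" if "(t, j) \<in> active" for t j
      using w(2)[of "Some (t, j)"] that by (simp add: I_def p_def)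
    ultimately have False using no_descent_direction[OF w(1) _ _ w(3) V] by blast
    then show thesis ..
  qed simp
qed

text \<open>The separation inequality couples all times through \<open>response\<close>. The adjoint
  equation rewrites the state part as a sum of terms each depending on the control variation at one
  time only, so the inequality can be tested time by time.\<close>

lemma adjoint_multipliers:
  obtains p \<eta>x \<eta>c \<eta>u where "\<And>t. t \<le> T \<Longrightarrow> linear (p t)"
    "\<eta>c \<ge> 0" "\<And>t j. \<eta>x t j \<ge> 0" "\<And>t j. (t, j) \<notin> active \<Longrightarrow> \<eta>x t j = 0"
    "\<And>i. i \<notin> {1..l} \<Longrightarrow> \<eta>u i = 0"
    "\<eta>c \<noteq> 0 \<or> (\<exists>(t, j)\<in>active. \<eta>x t j \<noteq> 0) \<or> (\<exists>i\<in>{1..l}. \<eta>u i \<noteq> 0)"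
    "\<And>v. p T v = - \<eta>c * cx T v - (\<Sum>j=1..n T. \<eta>x T j * gx T j v)"
    "\<And>t v. t < T \<Longrightarrow> p t v = p (Suc t) (fx t v) - \<eta>c * cx t v - (\<Sum>j=1..n t. \<eta>x t j * gx t j v)"
    "\<And>t w. t < T \<Longrightarrow> us t + w \<in> q t \<Longrightarrow> p (Suc t) (fu t w) - \<eta>c * cu t w + (\<Sum>i=1..l. \<eta>u i * (F t i \<bullet> w)) \<le> 0"
proof (rule multipliers_exist)
  fix \<eta>c \<eta>x \<eta>u assume \<eta>: "\<eta>c \<ge> 0" "\<And>t j. \<eta>x t j \<ge> 0" "\<And>t j. (t, j) \<notin> active \<Longrightarrow> \<eta>x t j = 0"
    "\<And>i. i \<notin> {1..l} \<Longrightarrow> \<eta>u i = 0"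
    "\<eta>c \<noteq> 0 \<or> (\<exists>(t, j)\<in>active. \<eta>x t j \<noteq> 0) \<or> (\<exists>i\<in>{1..l}. \<eta>u i \<noteq> 0)"
    and le: "\<And>w. (\<And>t. t < T \<Longrightarrow> us t + w t \<in> q t) \<Longrightarrow>
      (\<Sum>i=1..l. \<eta>u i * (\<Sum>t<T. F t i \<bullet> w t)) \<le>
      \<eta>c * dcost w + (\<Sum>(t, j)\<in>active. \<eta>x t j * gx t j (response w t))"
  define h where "h t v = \<eta>c * cx t v + (\<Sum>j=1..n t. \<eta>x t j * gx t j v)" for t v
  have lin_h: "linear (h t)" if "t \<le> T" for t
  proof -
    have "linear (\<lambda>v. \<eta>x t j * gx t j v)" if "j \<in> {1..n t}" for j
    \<comment> \<open>Differentiability of the state constraints is known only from time 1 on; at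
      time 0 no constraint is active and the multiplier vanishes.\<close>
    proof (cases "t = 0")
      case True
      then have "\<eta>x t j = 0" using \<eta>(3) by (simp add: active_def)
      then show ?thesis by (simp add: linear_zero)
    next
      case False
      then have "linear (gx t j)" using that \<open>t \<le> T\<close> by (intro linear_gx) auto
      from linear_compose_scale_right[OF this, of "\<eta>x t j"] show ?thesis by simp
    qed
    then have "linear (\<lambda>v. \<Sum>j=1..n t. \<eta>x t j * gx t j v)" by (intro linear_compose_sum) simp
    moreover have "linear (\<lambda>v. \<eta>c * cx t v)"
      using linear_compose_scale_right[OF linear_cx[OF that], of \<eta>c] by simp
    ultimately have "linear (\<lambda>v. \<eta>c * cx t v + (\<Sum>j=1..n t. \<eta>x t j * gx t j v))"
      by (rule linear_compose_add[rotated])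
    then show ?thesis by (simp add: h_def[abs_def])
  qed
  obtain p where p: "\<And>t. t \<le> T \<Longrightarrow> linear (p t)" "\<And>v. p T v = - h T v"
    "\<And>t v. t < T \<Longrightarrow> p t v = p (Suc t) (fx t v) - h t v"
    and duality: "\<And>\<xi> z. \<xi> 0 = 0 \<Longrightarrow> (\<And>t. t < T \<Longrightarrow> \<xi> (Suc t) = fx t (\<xi> t) + z t) \<Longrightarrow>
      (\<Sum>t<T. p (Suc t) (z t)) = - (\<Sum>t\<le>T. h t (\<xi> t))"
    by (rule discrete_adjoint[of T fx h]) (use linear_fx lin_h in auto)
  \<comment> \<open>The multipliers vanish off \<open>active\<close>, so the sum may run over the
    full range of indices on which \<open>h\<close> is defined.\<close>
  have sum_active: "(\<Sum>(t, j)\<in>active. \<eta>x t j * gx t j (response w t)) =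
      (\<Sum>t\<le>T. \<Sum>j=1..n t. \<eta>x t j * gx t j (response w t))" for w
  proof -
    have "(\<Sum>t\<le>T. \<Sum>j=1..n t. \<eta>x t j * gx t j (response w t)) =
        (\<Sum>(t, j)\<in>(SIGMA t:{..T}. {1..n t}). \<eta>x t j * gx t j (response w t))"
      by (subst sum.Sigma) auto
    also have "\<dots> = (\<Sum>(t, j)\<in>active. \<eta>x t j * gx t j (response w t))"
    proof (rule sum.mono_neutral_right)
      show "active \<subseteq> (SIGMA t:{..T}. {1..n t})" by (auto simp: active_def)
    qed (use \<eta>(3) in auto)
    finally show ?thesis by simp
  qed
  have hamiltonian: "p (Suc t) (fu t w) - \<eta>c * cu t w + (\<Sum>i=1..l. \<eta>u i * (F t i \<bullet> w)) \<le> 0"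
    if t: "t < T" and w: "us t + w \<in> q t" for t w
  proof -
    \<comment> \<open>Zero at the other times is a legitimate variation, because every cone contains
      its vertex.\<close>
    define w' where "w' s = (if s = t then w else 0)" for s
    have single: "(\<Sum>s<T. h' s (w' s)) = h' t w" if "\<And>s. s < T \<Longrightarrow> h' s 0 = 0" for h' :: "nat \<Rightarrow> real^'m \<Rightarrow> real"
    proof -
      have "(\<Sum>s<T. h' s (w' s)) = (\<Sum>s<T. if s = t then h' t w else 0)"
        using that by (intro sum.cong) (auto simp: w'_def)
      then show ?thesis using t by simp
    qed
    have "us s + w' s \<in> q s" if "s < T" for s
      using w control_cone(2,3)[OF that] cone_contains_0[of "control_cone s"]
      by (auto simp: w'_def control_cone_def)
    from le[of w', OF this]
    have "(\<Sum>i=1..l. \<eta>u i * (F t i \<bullet> w)) \<le>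
        \<eta>c * dcost w' + (\<Sum>t\<le>T. \<Sum>j=1..n t. \<eta>x t j * gx t j (response w' t))"
      using single[of "\<lambda>s. (\<bullet>) (F s _)"] by (simp add: sum_active)
    also have "\<dots> = \<eta>c * (\<Sum>s<T. cu s (w' s)) + (\<Sum>s\<le>T. h s (response w' s))"
      by (simp add: dcost_def h_def sum.distrib sum_distrib_left algebra_simps)
    also have "(\<Sum>s\<le>T. h s (response w' s)) = - (\<Sum>s<T. p (Suc s) (fu s (w' s)))"
      using duality[of "response w'" "\<lambda>s. fu s (w' s)"] by simp
    also have "(\<Sum>s<T. p (Suc s) (fu s (w' s))) = p (Suc t) (fu t w)"
      using linear_0[OF linear_fu] linear_0[OF p(1)]
      by (intro single[of "\<lambda>s v. p (Suc s) (fu s v)"]) auto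
    also have "(\<Sum>s<T. cu s (w' s)) = cu t w"
      using linear_0[OF linear_cu] by (intro single[of cu]) auto
    finally show ?thesis by simp
  qed
  show thesis
    by (rule that[of p \<eta>c \<eta>x \<eta>u]) (use p \<eta> hamiltonian in \<open>simp_all add: h_def\<close>)
qed

section \<open>Cotangent lifts and differentials along the optimal trajectory\<close>

lemma cotangent_lift_state:
  assumes t: "t < T" and v: "v \<in> tangent_space A (xs t)"
  shows "cotangent_lift A A (\<lambda>x. f t (x, us t)) (xs t) (chart_covector A (xs (Suc t)) h) v = h (fx t (v (ch t)))"
proof -
  have "continuous_map M (prod_topology M euclidean) (\<lambda>x. (x, us t))"
    by (simp add: continuous_map_pairwise o_def)
  moreover have "continuous_map (prod_topology M euclidean) M (f t)" using f[OF t] unfolding C1_map_def ..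
  ultimately have "continuous_map M M (f t \<circ> (\<lambda>x. (x, us t)))" by (rule continuous_map_compose)
  then have "continuous_map M M (\<lambda>x. f t (x, us t))" by (simp add: o_def)
  from cotangent_lift_chart_covector[OF M M this xs_topspace _ v, of h] partial_f(1)[OF t] t
  show ?thesis by (simp add: fx_def ch_def xs_Suc)
qed

lemma cotangent_lift_control:
  assumes t: "t < T"
  shows "cotangent_lift euc_atlas A (\<lambda>u. f t (xs t, u)) (us t) (chart_covector A (xs (Suc t)) h) (euc_tangent z)
    = h (fu t z)"
proof -
  have "continuous_map euclidean (prod_topology M euclidean) (\<lambda>u. (xs t, u))"
    using xs_topspace[of t] t by (simp add: continuous_map_pairwise o_def)
  moreover have "continuous_map (prod_topology M euclidean) M (f t)" using f[OF t] unfolding C1_map_def ..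
  ultimately have "continuous_map euclidean M (f t \<circ> (\<lambda>u. (xs t, u)))" by (rule continuous_map_compose)
  then have "continuous_map euclidean M (\<lambda>u. f t (xs t, u))" by (simp add: o_def)
  from cotangent_lift_chart_covector[OF smooth_manifold_euc M this _ _ euc_tangent_in_tangent_space, of "us t" h z]
    partial_f(2)[OF t] t
  show ?thesis by (simp add: fu_def ch_def xs_Suc some_chart_euc euc_tangent_def euc_chart_mem)
qed

lemma differential_control_cost: "differential euc_atlas (\<lambda>u. c t (xs t, u)) (us t) (euc_tangent z) = cu t z"
  using differential_apply[OF euc_tangent_in_tangent_space, of "\<lambda>u. c t (xs t, u)" "us t" z]
  by (simp add: some_chart_euc cu_def) (simp add: euc_tangent_def euc_chart_mem)

lemma differential_state_cost:
  "t < T \<Longrightarrow> v \<in> tangent_space A (xs t) \<Longrightarrow> differential A (\<lambda>x. c t (x, us t)) (xs t) v = cx t (v (ch t))"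
  by (simp add: differential_apply cx_def ch_def)

lemma differential_final_cost: "v \<in> tangent_space A (xs T) \<Longrightarrow> differential A cT (xs T) v = cx T (v (ch T))"
  by (simp add: differential_apply cx_def ch_def)

lemma cotangent_lift_state_constraint:
  "v \<in> tangent_space A (xs t) \<Longrightarrow>
    cotangent_lift_nvec A (n t) (g t) (xs t) y v = (\<Sum>j=1..n t. y j * gx t j (v (ch t)))"
  by (simp add: cotangent_lift_nvec_def differential_apply gx_def ch_def)

end

theorem theorem4p1:
  fixes M :: "'a topology" and A :: "('a, real^'d) chart set"
    and T l :: nat and n :: "nat \<Rightarrow> nat"
    and xbar :: 'a
    and f :: "nat \<Rightarrow> 'a \<times> (real^'m) \<Rightarrow> 'a"
    and c :: "nat \<Rightarrow> 'a \<times> (real^'m) \<Rightarrow> real" and cT :: "'a \<Rightarrow> real"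
    and g :: "nat \<Rightarrow> 'a \<Rightarrow> nat \<Rightarrow> real"
    and U q :: "nat \<Rightarrow> (real^'m) set"
    and W :: "'m \<Rightarrow> nat set" and F :: "nat \<Rightarrow> nat \<Rightarrow> real^'m"
    and xs :: "nat \<Rightarrow> 'a" and us :: "nat \<Rightarrow> real^'m"
  assumes "smooth_manifold M A" and "T \<ge> 1" and "xbar \<in> topspace M"
    and "\<And>t. t < T \<Longrightarrow>
           C1_map (prod_topology M euclidean) (prod_atlas A euc_atlas) M A (f t)"
    and "\<And>t. t < T \<Longrightarrow>
           C1_map (prod_topology M euclidean) (prod_atlas A euc_atlas) euclidean euc_atlas (c t)"
    and "C1_map M A euclidean euc_atlas cT"
    and "\<And>t j. t \<in> {1..T} \<Longrightarrow> j \<in> {1..n t} \<Longrightarrow> C1_map M A euclidean euc_atlas (\<lambda>x. g t x j)"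
    and "\<And>t. t < T \<Longrightarrow> U t \<noteq> {}"
    and "\<And>k. W k \<subseteq> {1..T}" and "encodes_frequency_constraint T W l F"
    and "optimal M T xbar f c cT n g U l F xs us"
    and "\<And>t. t < T \<Longrightarrow> local_tent (U t) (us t) (q t)"
  shows "\<exists>(\<eta>f :: nat \<Rightarrow> ('a, real^'d) tangent \<Rightarrow> real) (\<eta>x :: nat \<Rightarrow> nat \<Rightarrow> real)
            (\<eta>c :: real) (\<eta>u :: nat \<Rightarrow> real).
    (\<forall>t\<in>{1..T}. \<eta>f t \<in> cotangent_space A (xs t)) \<and>
    (\<forall>t\<in>{1..T}. \<eta>x t \<in> nvec (n t)) \<and>
    \<eta>u \<in> nvec l \<and>
    \<comment> \<open>non-negativity\<close>
    \<eta>c \<ge> 0 \<and> (\<forall>t\<in>{1..T}. \<forall>j\<in>{1..n t}. \<eta>x t j \<ge> 0) \<and>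
    \<comment> \<open>non-triviality\<close>
    \<not> ((\<forall>t\<in>{1..T}. \<eta>x t = (\<lambda>_. 0)) \<and> \<eta>c = 0 \<and> \<eta>u = (\<lambda>_. 0)) \<and>
    \<comment> \<open>state and adjoint dynamics\<close>
    (\<forall>t<T. xs (Suc t) = f t (xs t, us t)) \<and>
    (\<forall>t\<in>{1..<T}. \<forall>v\<in>tangent_space A (xs t).
       \<eta>f t v = cotangent_lift A A (\<lambda>x. f t (x, us t)) (xs t) (\<eta>f (Suc t)) v
                - \<eta>c * differential A (\<lambda>x. c t (x, us t)) (xs t) v
                - cotangent_lift_nvec A (n t) (g t) (xs t) (\<eta>x t) v) \<and>
    \<comment> \<open>transversality\<close>
    (\<forall>v\<in>tangent_space A (xs T).
       \<eta>f T v = - \<eta>c * differential A cT (xs T) v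
                - cotangent_lift_nvec A (n T) (g T) (xs T) (\<eta>x T) v) \<and>
    \<comment> \<open>Hamiltonian maximization, pointwise in time\<close>
    (\<forall>t<T. \<forall>w. us t + w \<in> q t \<longrightarrow>
       (euc_vector (cotangent_lift euc_atlas A (\<lambda>u. f t (xs t, u)) (us t) (\<eta>f (Suc t)))
        - \<eta>c *\<^sub>R euc_vector (differential euc_atlas (\<lambda>u. c t (xs t, u)) (us t))
        + (\<Sum>i=1..l. \<eta>u i *\<^sub>R F t i)) \<bullet> w \<le> 0) \<and>
    \<comment> \<open>complementary slackness\<close>
    (\<forall>t\<in>{1..T}. \<forall>j\<in>{1..n t}. \<eta>x t j * g t (xs t) j = 0)"
proof -
  interpret optimal_trajectory M A T l n xbar f c cT g U q F xs us
    using assms by unfold_locales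
  show ?thesis
  proof (rule adjoint_multipliers)
    fix p :: "nat \<Rightarrow> real^'d \<Rightarrow> real" and \<eta>x \<eta>c \<eta>u
    assume lin: "\<And>t. t \<le> T \<Longrightarrow> linear (p t)"
      and nonneg: "\<eta>c \<ge> 0" "\<And>t j. \<eta>x t j \<ge> 0"
      and inactive: "\<And>t j. (t, j) \<notin> active \<Longrightarrow> \<eta>x t j = 0"
      and support: "\<And>i. i \<notin> {1..l} \<Longrightarrow> \<eta>u i = 0"
      and nontrivial: "\<eta>c \<noteq> 0 \<or> (\<exists>(t, j)\<in>active. \<eta>x t j \<noteq> 0) \<or> (\<exists>i\<in>{1..l}. \<eta>u i \<noteq> 0)"
      and pT: "\<And>v. p T v = - \<eta>c * cx T v - (\<Sum>j=1..n T. \<eta>x T j * gx T j v)"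
      and p: "\<And>t v. t < T \<Longrightarrow> p t v = p (Suc t) (fx t v) - \<eta>c * cx t v - (\<Sum>j=1..n t. \<eta>x t j * gx t j v)"
      and ham: "\<And>t w. t < T \<Longrightarrow> us t + w \<in> q t \<Longrightarrow>
        p (Suc t) (fu t w) - \<eta>c * cu t w + (\<Sum>i=1..l. \<eta>u i * (F t i \<bullet> w)) \<le> 0"
    \<comment> \<open>The adjoint functionals live on coordinates; reading them through the chart
      \<open>ch t\<close> gives the covectors.\<close>
    define \<eta>f where "\<eta>f t = chart_covector A (xs t) (p t)" for t
    have \<eta>f: "\<eta>f t v = p t (v (ch t))" if "v \<in> tangent_space A (xs t)" for t v
      using that by (simp add: \<eta>f_def chart_covector_def ch_def)
    show ?thesis
    proof (intro exI[of _ \<eta>f] exI[of _ \<eta>x] exI[of _ \<eta>c] exI[of _ \<eta>u] conjI ballI allI impI)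
      show "\<eta>f t \<in> cotangent_space A (xs t)" if "t \<in> {1..T}" for t
        unfolding \<eta>f_def using that by (intro chart_covector_in_cotangent_space[OF assms(1)] lin) simp
      show "\<eta>x t \<in> nvec (n t)" if "t \<in> {1..T}" for t
        unfolding nvec_def
      proof (intro CollectI allI impI inactive)
        show "(t, j) \<notin> active" if "j \<notin> {1..n t}" for j using that by (auto simp: active_def)
      qed
      show "\<eta>u \<in> nvec l" using support by (simp add: nvec_def)
      show "\<not> ((\<forall>t\<in>{1..T}. \<eta>x t = (\<lambda>_. 0)) \<and> \<eta>c = 0 \<and> \<eta>u = (\<lambda>_. 0))"
        using nontrivial by (auto simp: active_def)
      show "xs (Suc t) = f t (xs t, us t)" if "t < T" for t using xs_Suc[OF that] .
      show "\<eta>f t v = cotangent_lift A A (\<lambda>x. f t (x, us t)) (xs t) (\<eta>f (Suc t)) v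
          - \<eta>c * differential A (\<lambda>x. c t (x, us t)) (xs t) v
          - cotangent_lift_nvec A (n t) (g t) (xs t) (\<eta>x t) v"
        if "t \<in> {1..<T}" "v \<in> tangent_space A (xs t)" for t v
      proof -
        have t: "t < T" using that(1) by simp
        show ?thesis
          unfolding \<eta>f[OF that(2)] \<eta>f_def[of "Suc t"] cotangent_lift_state[OF t that(2)]
            differential_state_cost[OF t that(2)] cotangent_lift_state_constraint[OF that(2)]
          by (rule p[OF t])
      qed
      show "\<eta>f T v = - \<eta>c * differential A cT (xs T) v
          - cotangent_lift_nvec A (n T) (g T) (xs T) (\<eta>x T) v"
        if "v \<in> tangent_space A (xs T)" for v
        unfolding \<eta>f[OF that] differential_final_cost[OF that] cotangent_lift_state_constraint[OF that]
        by (rule pT)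
      show "(euc_vector (cotangent_lift euc_atlas A (\<lambda>u. f t (xs t, u)) (us t) (\<eta>f (Suc t)))
          - \<eta>c *\<^sub>R euc_vector (differential euc_atlas (\<lambda>u. c t (xs t, u)) (us t))
          + (\<Sum>i=1..l. \<eta>u i *\<^sub>R F t i)) \<bullet> w \<le> 0"
        if t: "t < T" and w: "us t + w \<in> q t" for t w
      proof -
        \<comment> \<open>The inner product with \<open>euc_vector\<close> is determined by the
          values on \<open>euc_tangent\<close>, where the lift is the linear map
          \<open>p (Suc t)\<close> composed with \<open>fu t\<close>.\<close>
        have "euc_vector (cotangent_lift euc_atlas A (\<lambda>u. f t (xs t, u)) (us t) (\<eta>f (Suc t))) \<bullet> w = p (Suc t) (fu t w)"
          using linear_compose[OF linear_fu[OF t] lin[of "Suc t"]] t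
          by (intro inner_euc_vector) (simp_all add: o_def \<eta>f_def cotangent_lift_control)
        moreover have "euc_vector (differential euc_atlas (\<lambda>u. c t (xs t, u)) (us t)) \<bullet> w = cu t w"
          by (intro inner_euc_vector linear_cu t differential_control_cost)
        ultimately show ?thesis
          using ham[OF t w] by (simp add: inner_add_left inner_diff_left inner_sum_left)
      qed
      show "\<eta>x t j * g t (xs t) j = 0" if "t \<in> {1..T}" "j \<in> {1..n t}" for t j
        using inactive[of t j] that by (auto simp: active_def)
    qed (use nonneg in auto)
  qed
qed

end
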